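(* Let $\phi:\mathbb{R}^n\setminus\{0\}\to\mathbb{G}(k,E)$ be a homogeneous bundle whose restriction to $S^{n-1}$ is Hölder continuous with some exponent $>\tfrac12$, let $\mu\in M_\phi(\mathbb{R}^n,E)$ and let $A\subset\mathbb{R}^n$ be a Borel set. Then $$N(A)\subset\{u\in\mathbb{R}^n:\ \|u\|=1,\ \mu(A)\in\phi(u)\}.$$
   Context: $E=\mathbb{C}^m$; $\mathbb{G}(k,E)$ is the Grassmannian of $k$-dimensional subspaces of $E$ with a standard metric. A homogeneous bundle is a continuous $\phi:\mathbb{R}^n\setminus\{0\}\to\mathbb{G}(k,E)$ with $\phi(a\xi)=\phi(\xi)$ for $a>0$. $M_\phi(\mathbb{R}^n,E)$ is the set of finite $E$-valued Borel measures $\mu$ with $\hat\mu(\xi)\in\phi(\xi)$ for $\xi\ne0$ (coordinatewise Fourier transform $\hat\mu(\xi)=\int e^{-2\pi i\langle\xi,x\rangle}d\mu$). For $A\subset\mathbb{R}^n$, $N(A)=\{v\in\mathbb{R}^n:\|v\|=1,\ \lambda(p_v(A))=0\}$, where $p_v$ is the orthogonal projection onto $\mathrm{span}\{v\}$ and $\lambda$ is one-dimensional Lebesgue measure on that line. *)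

theory Defs
  imports "HOL-Analysis.Analysis"
begin

definition grassmannian :: "nat \<Rightarrow> ((complex ^ 'm) set) set" where
  "grassmannian k = {V. vec.subspace V \<and> vec.dim V = k}"

text \<open>Standard (gap) metric on the Grassmannian: operator norm of the difference
  of the orthogonal projections. (For a complex subspace the real orthogonal
  projection coincides with the Hermitian one.)\<close>
definition grass_dist :: "(complex ^ 'm) set \<Rightarrow> (complex ^ 'm) set \<Rightarrow> real" where
  "grass_dist V W = onorm (\<lambda>x. closest_point V x - closest_point W x)"

definition homogeneous_bundle :: "nat \<Rightarrow> (real ^ 'n \<Rightarrow> (complex ^ 'm) set) \<Rightarrow> bool" where
  "homogeneous_bundle k \<phi> \<longleftrightarrow>
     (\<forall>\<xi>. \<xi> \<noteq> 0 \<longrightarrow> \<phi> \<xi> \<in> grassmannian k) \<and>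
     (\<forall>\<xi> a. \<xi> \<noteq> 0 \<longrightarrow> a > 0 \<longrightarrow> \<phi> (a *\<^sub>R \<xi>) = \<phi> \<xi>) \<and>
     (\<forall>\<xi>. \<xi> \<noteq> 0 \<longrightarrow> (\<forall>e>0. \<exists>d>0. \<forall>\<eta>. \<eta> \<noteq> 0 \<longrightarrow> dist \<eta> \<xi> < d \<longrightarrow>
          grass_dist (\<phi> \<eta>) (\<phi> \<xi>) < e))"

definition holder_on_sphere :: "real \<Rightarrow> (real ^ 'n \<Rightarrow> (complex ^ 'm) set) \<Rightarrow> bool" where
  "holder_on_sphere \<alpha> \<phi> \<longleftrightarrow> (\<exists>C. \<forall>u\<in>sphere 0 1. \<forall>v\<in>sphere 0 1.
       grass_dist (\<phi> u) (\<phi> v) \<le> C * dist u v powr \<alpha>)"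

text \<open>A finite E-valued Borel measure is represented by its polar/Radon-Nikodym form
  mu = f d nu with nu a finite positive Borel measure and f nu-integrable.\<close>
definition vmeasure_of ::
  "(real ^ 'n) measure \<Rightarrow> (real ^ 'n \<Rightarrow> complex ^ 'm) \<Rightarrow> (real ^ 'n) set \<Rightarrow> complex ^ 'm" where
  "vmeasure_of \<nu> f A = set_lebesgue_integral \<nu> A f"

definition vfourier ::
  "(real ^ 'n) measure \<Rightarrow> (real ^ 'n \<Rightarrow> complex ^ 'm) \<Rightarrow> real ^ 'n \<Rightarrow> complex ^ 'm" where
  "vfourier \<nu> f \<xi> = integral\<^sup>L \<nu> (\<lambda>x. cis (- 2 * pi * (\<xi> \<bullet> x)) *s f x)"

definition in_M_phi ::
  "(real ^ 'n \<Rightarrow> (complex ^ 'm) set) \<Rightarrow> (real ^ 'n) measure \<Rightarrow> (real ^ 'n \<Rightarrow> complex ^ 'm) \<Rightarrow> bool" where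
  "in_M_phi \<phi> \<nu> f \<longleftrightarrow> sets \<nu> = sets borel \<and> finite_measure \<nu> \<and> integrable \<nu> f \<and>
     (\<forall>\<xi>. \<xi> \<noteq> 0 \<longrightarrow> vfourier \<nu> f \<xi> \<in> \<phi> \<xi>)"

text \<open>N(A): unit directions v such that the projection of A onto span{v} is
  one-dimensionally Lebesgue null (the line span{v} is identified isometrically
  with R via p_v(a) = (a.v) v  <->  a.v).\<close>
definition null_dirs :: "(real ^ 'n) set \<Rightarrow> (real ^ 'n) set" where
  "null_dirs A = {v. norm v = 1 \<and> (\<lambda>a. a \<bullet> v) ` A \<in> null_sets lebesgue}"

end

(*
  Fix v with p_v(A) null, let w be orthogonal to phi(v), and let g nu be the scalar measure <mu, w>.
  Since the transform of mu at k v + xi lies in phi(k v + xi), which by homogeneity and the Hoelder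
  condition is within O(k^(-alpha)) of phi(v), the coefficients of g nu at k v + xi (k = 0, 1, 2, ...)
  are square summable.  Only the half-line k >= 0 is available, because phi(-v) may differ from
  phi(v), so an argument like that of F. and M. Riesz is needed: for K compact in A, the image E of
  p_v(K) on the circle is a compact null set, and its indicator is the bounded pointwise limit of
  functions Phi_n analytic across the closed unit disc.  By Cauchy-Schwarz and Parseval, the integral
  of Phi_n(exp(-2 pi i x.v)) exp(-2 pi i xi.x) against g nu is at most a constant times the L^2 norm
  of Phi_n on the circle, which tends to 0.  Hence the restriction of g nu to the preimage of E,
  a set containing K, has zero Fourier transform and vanishes.
*)

theory Submission
  imports Defs "HOL-Complex_Analysis.Complex_Analysis"
begin

subsection \<open>Uniqueness of Fourier transforms of complex measures\<close>

definition character :: "'a::euclidean_space \<Rightarrow> 'a \<Rightarrow> complex" where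
  "character \<xi> x = cis (- 2 * pi * (\<xi> \<bullet> x))"

lemma norm_character [simp]: "norm (character \<xi> x) = 1"
  by (simp add: character_def)

lemma character_add: "character (\<xi> + \<eta>) x = character \<xi> x * character \<eta> x"
  by (simp add: character_def cis_mult inner_add_left distrib_left)

lemma continuous_on_character [continuous_intros]: "continuous_on S (character \<xi>)"
  unfolding character_def by (intro continuous_intros)

lemma borel_measurable_character [measurable]: "character \<xi> \<in> borel_measurable borel"
  by (intro borel_measurable_continuous_onI continuous_on_character)

lemma integrable_bounded_mult:
  fixes h g :: "'a \<Rightarrow> complex"
  assumes "h \<in> borel_measurable M" "\<And>x. norm (h x) \<le> C" "integrable M g"
  shows "integrable M (\<lambda>x. h x * g x)"
proof (rule Bochner_Integration.integrable_bound)
  show "integrable M (\<lambda>x. C * norm (g x))"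
    using assms(3) by simp
  show "(\<lambda>x. h x * g x) \<in> borel_measurable M"
    by (intro borel_measurable_times borel_measurable_integrable assms)
  have "0 \<le> C"
    using assms(2) norm_ge_zero order_trans by blast
  then show "AE x in M. norm (h x * g x) \<le> norm (C * norm (g x))"
    by (intro AE_I2) (simp add: norm_mult assms(2) mult_right_mono)
qed

lemma tendsto_integral_bounded_mult:
  fixes h :: "nat \<Rightarrow> 'a \<Rightarrow> complex"
  assumes "\<And>n. h n \<in> borel_measurable M" and "\<And>n x. norm (h n x) \<le> C"
    and "\<And>x. (\<lambda>n. h n x) \<longlonglongrightarrow> h' x" and "integrable M g"
  shows "(\<lambda>n. \<integral>x. h n x * g x \<partial>M) \<longlonglongrightarrow> (\<integral>x. h' x * g x \<partial>M)"
proof (rule integral_dominated_convergence)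
  have h': "h' \<in> borel_measurable M"
    by (rule borel_measurable_LIMSEQ_metric[OF assms(1,3)])
  show "(\<lambda>x. h' x * g x) \<in> borel_measurable M" "\<And>n. (\<lambda>x. h n x * g x) \<in> borel_measurable M"
    by (intro borel_measurable_times borel_measurable_integrable h' assms)+
  show "integrable M (\<lambda>x. C * norm (g x))"
    using assms(4) by simp
  show "AE x in M. (\<lambda>n. h n x * g x) \<longlonglongrightarrow> h' x * g x"
    by (intro AE_I2 tendsto_intros assms(3))
  show "\<And>n. AE x in M. norm (h n x * g x) \<le> C * norm (g x)"
    by (simp add: norm_mult assms(2) mult_right_mono)
qed

text \<open>The base measure is fixed and only the density \<open>g\<close> varies, so that the
  complex measure can be multiplied by bounded functions. Uniqueness follows by enlarging the class
  of admissible multipliers from characters to indicators of Borel sets.\<close>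

definition fourier_null :: "'a::euclidean_space measure \<Rightarrow> ('a \<Rightarrow> complex) \<Rightarrow> bool" where
  "fourier_null M g \<longleftrightarrow> integrable M g \<and> (\<forall>\<xi>. (\<integral>x. character \<xi> x * g x \<partial>M) = 0)"

text \<open>Quantifying over all \<open>g\<close> makes these functions closed under multiplication.\<close>
definition fourier_multiplier :: "'a::euclidean_space measure \<Rightarrow> ('a \<Rightarrow> complex) \<Rightarrow> bool" where
  "fourier_multiplier M h \<longleftrightarrow> h \<in> borel_measurable M \<and> (\<exists>C. \<forall>x. norm (h x) \<le> C) \<and>
     (\<forall>g. fourier_null M g \<longrightarrow> fourier_null M (\<lambda>x. h x * g x))"

lemma fourier_multiplierI:
  assumes "h \<in> borel_measurable M" "\<And>x. norm (h x) \<le> C"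
    and "\<And>g \<xi>. fourier_null M g \<Longrightarrow> (\<integral>x. character \<xi> x * (h x * g x) \<partial>M) = 0"
  shows "fourier_multiplier M h"
  using assms integrable_bounded_mult[OF assms(1,2)]
  unfolding fourier_multiplier_def fourier_null_def by blast

context
  fixes M :: "'a::euclidean_space measure"
  assumes sets_M [measurable_cong]: "sets M = sets borel"
begin

text \<open>Multiplication by a character translates the transform, and zero stays zero.\<close>

lemma fourier_multiplier_character: "fourier_multiplier M (character \<xi>)"
proof (rule fourier_multiplierI[where C = 1])
  fix g \<eta> assume "fourier_null M g"
  then have "(\<integral>x. character (\<eta> + \<xi>) x * g x \<partial>M) = 0"
    by (auto simp: fourier_null_def)
  then show "(\<integral>x. character \<eta> x * (character \<xi> x * g x) \<partial>M) = 0"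
    by (simp add: character_add mult.assoc)
qed auto

lemma fourier_multiplier_const: "fourier_multiplier M (\<lambda>_. c)"
proof (rule fourier_multiplierI[where C = "norm c"])
  fix g \<xi> assume "fourier_null M g"
  then have "c * (\<integral>x. character \<xi> x * g x \<partial>M) = 0"
    by (auto simp: fourier_null_def)
  then show "(\<integral>x. character \<xi> x * (c * g x) \<partial>M) = 0"
    by (simp add: mult.left_commute)
qed auto

lemma fourier_multiplier_mult:
  assumes "fourier_multiplier M h" "fourier_multiplier M h'"
  shows "fourier_multiplier M (\<lambda>x. h x * h' x)"
proof -
  obtain C C' where C: "\<And>x. norm (h x) \<le> C" "\<And>x. norm (h' x) \<le> C'"
    using assms by (auto simp: fourier_multiplier_def)
  show ?thesis
  proof (rule fourier_multiplierI[where C = "C * C'"])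
    fix x show "norm (h x * h' x) \<le> C * C'"
      unfolding norm_mult using C by (intro mult_mono) (auto intro: order_trans[OF norm_ge_zero C(1)])
  next
    fix g \<xi> assume "fourier_null M g"
    then have "fourier_null M (\<lambda>x. h x * (h' x * g x))"
      using assms by (auto simp: fourier_multiplier_def)
    then show "(\<integral>x. character \<xi> x * (h x * h' x * g x) \<partial>M) = 0"
      by (auto simp: fourier_null_def mult.assoc)
  qed (use assms in \<open>auto simp: fourier_multiplier_def\<close>)
qed

lemma fourier_multiplier_add:
  assumes "fourier_multiplier M h" "fourier_multiplier M h'"
  shows "fourier_multiplier M (\<lambda>x. h x + h' x)"
proof -
  obtain C C' where C: "\<And>x. norm (h x) \<le> C" "\<And>x. norm (h' x) \<le> C'"
    using assms by (auto simp: fourier_multiplier_def)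
  show ?thesis
  proof (rule fourier_multiplierI[where C = "C + C'"])
    fix x show "norm (h x + h' x) \<le> C + C'"
      using C by (intro norm_triangle_le add_mono)
  next
    fix g \<xi> assume "fourier_null M g"
    then have *: "fourier_null M (\<lambda>x. h x * g x)" "fourier_null M (\<lambda>x. h' x * g x)"
      using assms by (auto simp: fourier_multiplier_def)
    have "integrable M (\<lambda>x. character \<xi> x * (h x * g x))" "integrable M (\<lambda>x. character \<xi> x * (h' x * g x))"
      using * by (auto simp: fourier_null_def intro!: integrable_bounded_mult[where C = 1])
    then show "(\<integral>x. character \<xi> x * ((h x + h' x) * g x) \<partial>M) = 0"
      using * by (simp add: fourier_null_def algebra_simps)
  qed (use assms in \<open>auto simp: fourier_multiplier_def\<close>)
qed

lemma fourier_multiplier_LIMSEQ: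
  assumes "\<And>n. fourier_multiplier M (h n)" "\<And>n x. norm (h n x) \<le> C"
    and "\<And>x. (\<lambda>n. h n x) \<longlonglongrightarrow> h' x"
  shows "fourier_multiplier M h'"
proof (rule fourier_multiplierI[where C = C])
  have meas: "h n \<in> borel_measurable M" for n
    using assms(1) by (auto simp: fourier_multiplier_def)
  then show "h' \<in> borel_measurable M"
    by (rule borel_measurable_LIMSEQ_metric[OF _ assms(3)])
  show "norm (h' x) \<le> C" for x
    using assms(2) by (intro Lim_bounded[OF tendsto_norm[OF assms(3)]]) auto
  fix g \<xi> assume g: "fourier_null M g"
  have "(\<integral>x. character \<xi> x * (h n x * g x) \<partial>M) = 0" for n
    using g assms(1) by (auto simp: fourier_multiplier_def fourier_null_def)
  moreover have "(\<lambda>n. \<integral>x. h n x * (character \<xi> x * g x) \<partial>M) \<longlonglongrightarrow> (\<integral>x. h' x * (character \<xi> x * g x) \<partial>M)"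
    using g meas assms(2,3)
    by (intro tendsto_integral_bounded_mult[where C = C] integrable_bounded_mult[where C = 1])
       (auto simp: fourier_null_def)
  ultimately show "(\<integral>x. character \<xi> x * (h' x * g x) \<partial>M) = 0"
    by (simp add: mult.left_commute LIMSEQ_const_iff)
qed

lemma fourier_multiplier_real_polynomial:
  fixes s :: "'a \<Rightarrow> real"
  assumes "real_polynomial_function p" "fourier_multiplier M (\<lambda>x. of_real (s x))"
  shows "fourier_multiplier M (\<lambda>x. of_real (p (s x)))"
  using assms(1)
proof (induction p)
  case (linear p)
  then obtain c where "p = (\<lambda>x. x * c)"
    by (auto simp: real_bounded_linear)
  then show ?case
    using fourier_multiplier_mult[OF assms(2) fourier_multiplier_const] by simp
qed (auto intro: fourier_multiplier_const fourier_multiplier_add fourier_multiplier_mult)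

text \<open>By Weierstrass on the bounded range of \<open>s\<close>, polynomials in \<open>s\<close>
  approximate ramps, whose pointwise limit is the discontinuous indicator of positivity.\<close>

lemma fourier_multiplier_positive_part:
  fixes s :: "'a \<Rightarrow> real"
  assumes s: "fourier_multiplier M (\<lambda>x. of_real (s x))"
  shows "fourier_multiplier M (\<lambda>x. of_bool (s x > 0))"
proof -
  obtain C where C: "\<And>x. norm (of_real (s x) :: complex) \<le> C"
    using s by (auto simp: fourier_multiplier_def)
  \<comment> \<open>For n > 0 the ramp vanishes for t \<le> 0 and equals 1 from t = 1/n on, so the
    limit at 0 is 0, matching the strict inequality.\<close>
  define ramp where "ramp n t = max 0 (min 1 (real n * t))" for n and t :: real
  have "\<exists>p. real_polynomial_function p \<and> (\<forall>t\<in>{-C..C}. \<bar>ramp n t - p t\<bar> < 1 / Suc n)" for n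
  proof -
    have "continuous_on {-C..C} (ramp n)"
      unfolding ramp_def by (intro continuous_intros)
    then show ?thesis
      using Stone_Weierstrass_real_polynomial_function[of "{-C..C}" "ramp n" "1 / Suc n"]
      by (metis compact_Icc divide_pos_pos of_nat_0_less_iff zero_less_Suc zero_less_one)
  qed
  then obtain p where p: "\<And>n. real_polynomial_function (p n)"
    and p': "\<And>n t. t \<in> {-C..C} \<Longrightarrow> \<bar>ramp n t - p n t\<bar> < 1 / Suc n"
    by metis
  have sC: "s x \<in> {-C..C}" for x
    using C[of x] by auto
  show ?thesis
  proof (rule fourier_multiplier_LIMSEQ)
    show "fourier_multiplier M (\<lambda>x. of_real (p n (s x)))" for n
      by (rule fourier_multiplier_real_polynomial[OF p s])
    \<comment> \<open>The bound is 1 for the ramp plus at most 1 for the approximation error,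
      uniformly in \<open>n\<close>.\<close>
    show "norm (of_real (p n (s x)) :: complex) \<le> 2" for n x
    proof -
      have "\<bar>ramp n (s x)\<bar> \<le> 1" "1 / real (Suc n) \<le> 1"
        by (auto simp: ramp_def)
      then show ?thesis
        using p'[OF sC[of x], of n] unfolding norm_of_real by linarith
    qed
    fix x
    have "(\<lambda>n. p n (s x) - ramp n (s x)) \<longlonglongrightarrow> 0"
      by (rule Lim_null_comparison[OF _ LIMSEQ_Suc[OF lim_1_over_n]])
         (use p'[OF sC] in \<open>auto simp: abs_minus_commute intro!: always_eventually less_imp_le\<close>)
    moreover have "(\<lambda>n. ramp n (s x)) \<longlonglongrightarrow> of_bool (s x > 0)"
    proof (rule tendsto_eventually)
      obtain N where N: "s x > 0 \<Longrightarrow> real N * s x > 1"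
        using reals_Archimedean3 by blast
      have "ramp n (s x) = of_bool (s x > 0)" if "n \<ge> N" for n
      proof (cases "s x > 0")
        case True
        then have "real N * s x \<le> real n * s x"
          using that by simp
        then have "1 \<le> real n * s x"
          using N[OF True] by linarith
        then show ?thesis
          using True by (simp add: ramp_def)
      next
        case False
        then have "real n * s x \<le> 0"
          by (simp add: mult_le_0_iff)
        then show ?thesis using False by (auto simp: ramp_def)
      qed
      then show "\<forall>\<^sub>F n in sequentially. ramp n (s x) = of_bool (s x > 0)"
        unfolding eventually_sequentially by blast
    qed
    ultimately have "(\<lambda>n. p n (s x)) \<longlonglongrightarrow> of_bool (s x > 0)"
      using tendsto_add by fastforce
    then have "(\<lambda>n. complex_of_real (p n (s x))) \<longlonglongrightarrow> of_real (of_bool (s x > 0))"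
      by (rule tendsto_of_real)
    then show "(\<lambda>n. complex_of_real (p n (s x))) \<longlonglongrightarrow> of_bool (s x > 0)"
      by (cases "s x > 0") auto
  qed
qed

lemma fourier_multiplier_sin: "fourier_multiplier M (\<lambda>x. of_real (sin (a + \<xi> \<bullet> x)))"
proof -
  \<comment> \<open>Euler's formula; \<open>character\<close> carries the factor -2 pi, whence the
    frequencies with 1 / (2 pi).\<close>
  have *: "complex_of_real (sin (a + \<xi> \<bullet> x)) =
      cis a / (2 * \<i>) * character (- (1 / (2 * pi)) *\<^sub>R \<xi>) x +
      - cis (- a) / (2 * \<i>) * character ((1 / (2 * pi)) *\<^sub>R \<xi>) x" for x
    by (simp add: character_def complex_eq_iff sin_add Re_divide Im_divide power2_eq_square field_simps)
  show ?thesis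
    unfolding *
    by (intro fourier_multiplier_add fourier_multiplier_mult fourier_multiplier_const
        fourier_multiplier_character)
qed

text \<open>At each point, square waves of growing period eventually take the value of the half-space.\<close>
lemma fourier_multiplier_halfspace: "fourier_multiplier M (\<lambda>x. of_bool (x \<bullet> i < a))"
proof (rule fourier_multiplier_LIMSEQ)
  show "fourier_multiplier M (\<lambda>x. of_bool (sin (a / Suc n + (- (1 / Suc n) *\<^sub>R i) \<bullet> x) > 0))" for n
    by (intro fourier_multiplier_positive_part fourier_multiplier_sin)
  fix x
  define t where "t = a - x \<bullet> i"
  obtain N where N: "\<bar>t\<bar> < real N"
    using reals_Archimedean2 by blast
  have "(sin (a / Suc n + (- (1 / Suc n) *\<^sub>R i) \<bullet> x) > 0) = (x \<bullet> i < a)" if "n \<ge> N" for n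
  proof -
    have eq: "a / Suc n + (- (1 / Suc n) *\<^sub>R i) \<bullet> x = t / Suc n"
      by (simp add: t_def diff_divide_distrib inner_commute)
    \<comment> \<open>Inside (-pi, pi) the sine has the sign of its argument; for t = 0 both sides
      of the equivalence are false.\<close>
    have "\<bar>t / Suc n\<bar> < 1"
      using that N by (simp add: field_simps)
    then have le: "\<bar>t / Suc n\<bar> < pi"
      using pi_gt3 by linarith
    show ?thesis
    proof (cases "t > 0")
      case True
      then have "sin (t / Suc n) > 0"
        using le by (intro sin_gt_zero) auto
      then show ?thesis
        unfolding eq using True by (simp add: t_def)
    next
      case False
      then have "sin (- (t / Suc n)) \<ge> 0"
        using le by (intro sin_ge_zero) (auto simp: divide_nonpos_pos)
      then show ?thesis
        unfolding eq using False by (simp add: t_def)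
    qed
  qed
  then show "(\<lambda>n. of_bool (sin (a / Suc n + (- (1 / Suc n) *\<^sub>R i) \<bullet> x) > 0)) \<longlonglongrightarrow>
      (of_bool (x \<bullet> i < a) :: complex)"
    by (intro tendsto_eventually eventually_sequentiallyI[of N]) simp
qed auto

text \<open>Half-spaces generate the Borel sets, and the multipliers form an algebra closed under
  bounded pointwise limits.\<close>

lemma fourier_multiplier_borel:
  assumes "B \<in> sets borel"
  shows "fourier_multiplier M (indicator B)"
proof -
  have "B \<in> sigma_sets UNIV ((\<lambda>(a, i). {x::'a. x \<bullet> i < a}) ` (UNIV \<times> Basis))"
    using assms by (simp add: borel_eq_halfspace_less)
  then show ?thesis
  proof induction
    case (Basic B)
    then obtain a i where "B = {x. x \<bullet> i < a}" by auto
    then have "indicator B = (\<lambda>x. of_bool (x \<bullet> i < a) :: complex)"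
      by (auto simp: indicator_def)
    then show ?case
      by (simp add: fourier_multiplier_halfspace)
  next
    case Empty
    then show ?case using fourier_multiplier_const[of 0] by simp
  next
    case (Compl B)
    have "indicator (UNIV - B) = (\<lambda>x. 1 + - 1 * indicator B x :: complex)"
      by (auto simp: indicator_def)
    then show ?case
      using Compl fourier_multiplier_add fourier_multiplier_mult fourier_multiplier_const by presburger
  next
    case (Union B)
    \<comment> \<open>The sets of the induction need not be disjoint. Finite unions come first, each
      new set being cut by the complement of the earlier ones; the countable union is then a
      pointwise limit.\<close>
    have fin: "fourier_multiplier M (indicator (\<Union>i<n. B i))" for n
    proof (induction n)
      case 0
      then show ?case using fourier_multiplier_const[of 0] by simp
    next
      case (Suc n)
      let ?U = "\<Union>i<n. B i"
      have "indicator (\<Union>i<Suc n. B i) = (\<lambda>x. indicator ?U x + indicator (B n) x * (1 + - 1 * indicator ?U x) :: complex)"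
        by (auto simp: indicator_def fun_eq_iff lessThan_Suc)
      then show ?case
        using Suc Union fourier_multiplier_add fourier_multiplier_mult fourier_multiplier_const by presburger
    qed
    show ?case
    proof (rule fourier_multiplier_LIMSEQ[OF fin])
      show "norm (indicator (\<Union>i<n. B i) x :: complex) \<le> 1" for n x
        by (simp add: indicator_def)
      show "(\<lambda>n. indicator (\<Union>i<n. B i) x) \<longlonglongrightarrow> (indicator (\<Union>i. B i) x :: complex)" for x
        by (rule LIMSEQ_indicator_UN)
    qed
  qed
qed

text \<open>The integral is the transform, at frequency 0, of the density multiplied by the
  indicator. This is the uniqueness theorem in the form used below.\<close>

lemma fourier_null_imp_integral_eq_0:
  assumes "fourier_null M g" "B \<in> sets borel"
  shows "(\<integral>x. indicator B x * g x \<partial>M) = 0"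
proof -
  have "(\<integral>x. character 0 x * (indicator B x * g x) \<partial>M) = 0"
    using fourier_multiplier_borel[OF assms(2)] assms(1)
    by (auto simp: fourier_multiplier_def fourier_null_def)
  then show ?thesis
    by (simp add: character_def)
qed

end

subsection \<open>Peak functions for null sets of the circle\<close>

text \<open>Enclose \<open>K\<close> in an open set \<open>U\<close> of measure below
  \<open>e\<close>. By compactness \<open>K\<close> has positive distance \<open>d\<close> from the
  complement, so once 1/q < d every grid cell of length 1/q meeting \<open>K\<close> lies in
  \<open>U\<close>. The cells are disjoint, so their total length is at most the measure of
  \<open>U\<close>.\<close>

lemma compact_null_grid_cover:
  fixes K :: "real set"
  assumes "compact K" "K \<in> null_sets lebesgue" "e > 0"
  shows "\<forall>\<^sub>F q in sequentially. finite ((\<lambda>y. \<lfloor>real q * y\<rfloor>) ` K) \<and>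
    real (card ((\<lambda>y. \<lfloor>real q * y\<rfloor>) ` K)) \<le> e * real q"
proof -
  obtain U where U: "open U" "K \<subseteq> U" "U - K \<in> lmeasurable" "emeasure lebesgue (U - K) < ennreal e"
    using sets_lebesgue_outer_open assms by (metis null_setsD2)
  have "emeasure lebesgue U = emeasure lebesgue (U - K)"
    using assms(2) U(1) by (intro emeasure_Diff_null_set[symmetric]) auto
  then have lessU: "emeasure lborel U < ennreal e"
    using U by simp
  obtain d where d: "d > 0" "\<And>x y. x \<in> K \<Longrightarrow> y \<in> - U \<Longrightarrow> d \<le> dist x y"
    using separate_compact_closed[of K "- U"] assms(1) U(1,2) by (metis closed_Compl disjoint_eq_subset_Compl double_compl)
  obtain R where R: "\<And>y. y \<in> K \<Longrightarrow> \<bar>y\<bar> \<le> R"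
    using compact_imp_bounded[OF assms(1)] by (auto simp: bounded_iff)
  obtain Q :: nat where Q: "1 / d < real Q"
    using reals_Archimedean2 by blast
  have "finite ((\<lambda>y. \<lfloor>real q * y\<rfloor>) ` K) \<and> real (card ((\<lambda>y. \<lfloor>real q * y\<rfloor>) ` K)) \<le> e * real q"
    if "q \<ge> Q" for q
  proof -
    define J where "J = (\<lambda>y. \<lfloor>real q * y\<rfloor>) ` K"
    have "1 / d > 0" using d by simp
    then have "real q > 0" "1 / d < real q"
      using Q that by linarith+
    then have q: "real q > 0" "1 / real q < d"
      using d by (auto simp: field_simps)
    \<comment> \<open>Finiteness needs its own proof, because \<open>card\<close> of an infinite set
      is 0.\<close>
    have "J \<subseteq> {\<lfloor>real q * - R\<rfloor>..\<lfloor>real q * R\<rfloor>}"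
    proof
      fix i assume "i \<in> J"
      then obtain y where y: "y \<in> K" "i = \<lfloor>real q * y\<rfloor>"
        by (auto simp: J_def)
      have "real q * - R \<le> real q * y" "real q * y \<le> real q * R"
        using R[OF y(1)] q by (intro mult_left_mono; linarith)+
      then show "i \<in> {\<lfloor>real q * - R\<rfloor>..\<lfloor>real q * R\<rfloor>}"
        unfolding y(2) atLeastAtMost_iff using floor_mono by blast
    qed
    then have fin: "finite J"
      by (rule finite_subset) simp
    define cell where "cell i = {of_int i / real q..<(of_int i + 1) / real q}" for i :: int
    have cell_iff: "y \<in> cell i \<longleftrightarrow> \<lfloor>real q * y\<rfloor> = i" for y i
      using q by (simp add: cell_def floor_eq_iff field_simps)
    have cell_U: "cell i \<subseteq> U" if "i \<in> J" for i
    proof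
      fix t assume t: "t \<in> cell i"
      obtain y where y: "y \<in> K" "y \<in> cell i"
        using \<open>i \<in> J\<close> unfolding J_def cell_iff by auto
      have "dist y t \<le> 1 / real q"
        using t y(2) by (auto simp: cell_def dist_real_def add_divide_distrib)
      then show "t \<in> U"
        using d(2)[OF y(1), of t] q by auto
    qed
    have "ennreal (real (card J) / real q) = (\<Sum>i\<in>J. ennreal (1 / real q))"
      by (simp add: ennreal_of_nat_eq_real_of_nat ennreal_mult[symmetric])
    also have "\<dots> = (\<Sum>i\<in>J. emeasure lborel (cell i))"
      using q by (intro sum.cong) (auto simp: cell_def field_simps)
    also have "\<dots> = emeasure lborel (\<Union>i\<in>J. cell i)"
    proof (rule sum_emeasure)
      show "disjoint_family_on cell J"
        unfolding disjoint_family_on_def by (auto simp: cell_iff)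
    qed (auto simp: cell_def fin)
    also have "\<dots> \<le> emeasure lborel U"
      using cell_U U(1) by (intro emeasure_mono) auto
    finally have "ennreal (real (card J) / real q) < ennreal e"
      using lessU by order
    then have "real (card J) / real q < e"
      by (simp add: ennreal_less_iff)
    then show ?thesis
      using q fin unfolding J_def[symmetric] by (simp add: field_simps)
  qed
  then show ?thesis
    by (auto simp: eventually_sequentially)
qed

lemma dist_cis_le: "dist (cis a) (cis b) \<le> \<bar>a - b\<bar>"
proof -
  have "cis b * (cis (a - b) - 1) = cis a - cis b"
    by (simp add: algebra_simps cis_mult)
  then have "dist (cis a) (cis b) = norm (cis (a - b) - 1)"
    by (metis dist_norm mult_1 norm_cis norm_mult)
  also have "\<dots> \<le> \<bar>a - b\<bar>"
    using dist_exp_i_1[of "a - b"] abs_sin_x_le_abs_x[of "(a - b) / 2"]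
    by (simp add: cis_conv_exp)
  finally show ?thesis .
qed

text \<open>The grid on the line is wrapped around the circle. The bound on the total radius is
  quadratic in 1/N because the peak function multiplies the resulting sum by N; nearness of each
  centre to \<open>E\<close> is needed for estimates away from \<open>E\<close>.\<close>

lemma circle_null_cover:
  fixes K :: "real set"
  defines "E \<equiv> (\<lambda>y. cis (- 2 * pi * y)) ` K"
  assumes K: "compact K" "K \<in> null_sets lebesgue" and N: "N > (0::nat)"
  obtains B \<delta> where "finite B" "B \<subseteq> sphere 0 1" "0 < \<delta>" "\<delta> \<le> 1 / real N"
    "real (card B) * \<delta> \<le> 1 / (real N)\<^sup>2"
    "\<And>w. w \<in> E \<Longrightarrow> \<exists>b\<in>B. dist w b \<le> \<delta>" "\<And>b. b \<in> B \<Longrightarrow> \<exists>w\<in>E. dist w b \<le> \<delta>"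
proof -
  \<comment> \<open>The radius will be 7/q, where 7 exceeds 2 pi. This choice of \<open>e\<close>
    gives total radius at most 1/N^2, and q \<ge> 7 N gives radius at most 1/N.\<close>
  have "1 / (7 * (real N)\<^sup>2) > 0"
    using N by simp
  from eventually_conj[OF compact_null_grid_cover[OF K this] eventually_ge_at_top[of "7 * N"]]
  obtain q where q: "finite ((\<lambda>y. \<lfloor>real q * y\<rfloor>) ` K)"
      "real (card ((\<lambda>y. \<lfloor>real q * y\<rfloor>) ` K)) \<le> 1 / (7 * (real N)\<^sup>2) * real q" "q \<ge> 7 * N"
    by (auto simp: eventually_sequentially)
  define J where "J = (\<lambda>y. \<lfloor>real q * y\<rfloor>) ` K"
  have qpos: "real q > 0" and q7: "real q \<ge> 7 * real N"
    using q(3) N by auto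
  define b where "b i = cis (- 2 * pi * (of_int i / real q))" for i :: int
  have near: "dist (cis (- 2 * pi * y)) (b \<lfloor>real q * y\<rfloor>) \<le> 7 / real q" for y
  proof -
    have "\<bar>real q * y - of_int \<lfloor>real q * y\<rfloor>\<bar> \<le> 1"
      by linarith
    then have "\<bar>real q * y - of_int \<lfloor>real q * y\<rfloor>\<bar> / real q \<le> 1 / real q"
      using qpos by (intro divide_right_mono) auto
    also have "\<bar>real q * y - of_int \<lfloor>real q * y\<rfloor>\<bar> / real q = \<bar>y - of_int \<lfloor>real q * y\<rfloor> / real q\<bar>"
      using qpos by (subst abs_div_pos) (auto simp: diff_divide_distrib)
    finally have "(2 * pi) * \<bar>y - of_int \<lfloor>real q * y\<rfloor> / real q\<bar> \<le> 7 * (1 / real q)"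
      using pi_less_4 pi_approx by (intro mult_mono) auto
    moreover have "\<bar>- 2 * pi * y - - 2 * pi * z\<bar> = 2 * pi * \<bar>y - z\<bar>" for z
    proof -
      have "- 2 * pi * y - - 2 * pi * z = (2 * pi) * (z - y)"
        by (simp add: algebra_simps)
      then show ?thesis
        by (simp only: abs_mult) (simp add: abs_minus_commute)
    qed
    ultimately have "\<bar>- 2 * pi * y - - 2 * pi * (of_int \<lfloor>real q * y\<rfloor> / real q)\<bar> \<le> 7 / real q"
      by (metis mult_1_right times_divide_eq_right)
    then show ?thesis
      unfolding b_def by (rule order_trans[OF dist_cis_le])
  qed
  show ?thesis
  proof (rule that[of "b ` J" "7 / real q"])
    show "finite (b ` J)" "b ` J \<subseteq> sphere 0 1" "0 < 7 / real q"
      using q(1) qpos by (auto simp: J_def b_def)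
    show "7 / real q \<le> 1 / real N"
      using q7 N qpos by (simp add: field_simps)
    have "real (card (b ` J)) * (7 / real q) \<le> real (card J) * (7 / real q)"
      using q(1) qpos by (intro mult_right_mono) (auto simp: J_def card_image_le)
    also have "\<dots> \<le> (1 / (7 * (real N)\<^sup>2) * real q) * (7 / real q)"
      using q(2) qpos by (intro mult_right_mono) (auto simp: J_def)
    also have "\<dots> = 1 / (real N)\<^sup>2"
      using qpos by simp
    finally show "real (card (b ` J)) * (7 / real q) \<le> 1 / (real N)\<^sup>2" .
    show "\<exists>c\<in>b ` J. dist w c \<le> 7 / real q" if "w \<in> E" for w
      using that near by (auto simp: E_def J_def)
    show "\<exists>w\<in>E. dist w c \<le> 7 / real q" if "c \<in> b ` J" for c
      using that near by (auto simp: E_def J_def)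
  qed
qed

text \<open>Sum the kernels \<open>T b\<close>, whose poles (1 + \<delta>) b lie just outside the
  closed disc, to \<open>H\<close> and put \<Phi> = 1 - exp(-N H). On the circle Re H \<ge> 0 bounds
  \<Phi> by 2; on \<open>E\<close> a nearby centre gives Re H \<ge> 1/4, so the exponential is
  small; away from \<open>E\<close> the small total radius makes N H, hence \<Phi>, small.\<close>

lemma circle_peak_function:
  fixes K :: "real set"
  defines "E \<equiv> (\<lambda>y. cis (- 2 * pi * y)) ` K"
  assumes K: "compact K" "K \<in> null_sets lebesgue" and N: "N > (0::nat)"
  obtains \<Phi> r where "r > 1" "\<Phi> holomorphic_on ball 0 r"
    "\<And>w. norm w = 1 \<Longrightarrow> norm (\<Phi> w) \<le> 2"
    "\<And>w. w \<in> E \<Longrightarrow> norm (\<Phi> w - 1) \<le> 4 / real N"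
    "\<And>w d. norm w = 1 \<Longrightarrow> 3 / real N \<le> d \<Longrightarrow> (\<And>z. z \<in> E \<Longrightarrow> d \<le> dist w z) \<Longrightarrow>
       norm (\<Phi> w) \<le> 3 / (real N * d)"
proof -
  obtain B \<delta> where B: "finite B" "B \<subseteq> sphere 0 1" and \<delta>: "0 < \<delta>" "\<delta> \<le> 1 / real N"
    "real (card B) * \<delta> \<le> 1 / (real N)\<^sup>2"
    and EB: "\<And>w. w \<in> E \<Longrightarrow> \<exists>b\<in>B. dist w b \<le> \<delta>" and BE: "\<And>b. b \<in> B \<Longrightarrow> \<exists>w\<in>E. dist w b \<le> \<delta>"
    using circle_null_cover[OF K N] unfolding E_def by metis
  \<comment> \<open>Each \<open>T b\<close> has nonnegative real part on the circle, and real part at least 1/4 near \<open>b\<close>.\<close>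
  define T where "T b w = of_real \<delta> / (of_real (1 + \<delta>) - w * cnj b)" for b w
  define H where "H w = (\<Sum>b\<in>B. T b w)" for w
  define \<Phi> where "\<Phi> w = 1 - exp (- (of_nat N * H w))" for w
  have ReT: "Re (T b w) \<ge> 0" if "b \<in> B" "norm w = 1" for b w
  proof -
    have "Re (w * cnj b) \<le> norm (w * cnj b)" by (rule complex_Re_le_cmod)
    also have "\<dots> = 1" using that B by (auto simp: norm_mult)
    finally show ?thesis
      using \<delta> by (simp add: T_def Re_divide')
  qed
  have ReH: "Re (H w) \<ge> 0" if "norm w = 1" for w
    using ReT that by (auto simp: H_def intro!: sum_nonneg)
  have nE: "norm w = 1" if "w \<in> E" for w
    using that by (auto simp: E_def)
  have diff: "norm (1 - w * cnj b) = dist w b" if "b \<in> B" for b w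
  proof -
    have "norm b = 1" using that B by auto
    then have "norm (1 - w * cnj b) = norm (b * (1 - w * cnj b))" by (simp add: norm_mult)
    also have "b * (1 - w * cnj b) = b - w"
      using \<open>norm b = 1\<close> complex_norm_square[of b] by (simp add: algebra_simps)
    finally show ?thesis by (simp add: dist_norm norm_minus_commute)
  qed
  \<comment> \<open>With z the denominator, Re z \<ge> \<delta> and |z| \<le> 2 \<delta>, while Re
    (\<delta> / z) = \<delta> Re z / |z|^2.\<close>
  have ReT': "Re (T b w) \<ge> 1 / 4" if "b \<in> B" "norm w = 1" "dist w b \<le> \<delta>" for b w
  proof -
    define z where "z = of_real (1 + \<delta>) - w * cnj b"
    have "Re (w * cnj b) \<le> norm (w * cnj b)" by (rule complex_Re_le_cmod)
    also have "\<dots> = 1" using that B by (auto simp: norm_mult)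
    finally have Re: "Re z \<ge> \<delta>" by (simp add: z_def)
    have "norm z = norm (of_real \<delta> + (1 - w * cnj b))" by (simp add: z_def algebra_simps)
    also have "\<dots> \<le> norm (of_real \<delta> :: complex) + norm (1 - w * cnj b)" by (rule norm_triangle_ineq)
    also have "\<dots> \<le> 2 * \<delta>"
      using that(3) \<delta> unfolding diff[OF that(1)] by simp
    finally have "(norm z)\<^sup>2 \<le> (2 * \<delta>)\<^sup>2" by (intro power_mono) auto
    then have "1 / 4 * (norm z)\<^sup>2 \<le> \<delta> * \<delta>" by (simp add: power2_eq_square)
    also have "\<dots> \<le> \<delta> * Re z" using Re \<delta> by simp
    finally have "1 / 4 \<le> \<delta> * Re z / (norm z)\<^sup>2"
      using Re \<delta> by (subst le_divide_eq) auto
    then show ?thesis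
      unfolding T_def z_def[symmetric] by (simp add: Re_divide')
  qed
  show ?thesis
  proof (rule that[of "1 + \<delta>" \<Phi>])
    show "1 + \<delta> > 1" using \<delta> by simp
    have "of_real (1 + \<delta>) - w * cnj b \<noteq> 0" if "b \<in> B" "w \<in> ball 0 (1 + \<delta>)" for b w
    proof
      assume "of_real (1 + \<delta>) - w * cnj b = 0"
      then have "norm (complex_of_real (1 + \<delta>)) = norm (w * cnj b)" by simp
      then show False using that B \<delta> by (auto simp: norm_mult simp del: of_real_add)
    qed
    then show "\<Phi> holomorphic_on ball 0 (1 + \<delta>)"
      unfolding \<Phi>_def H_def T_def by (intro holomorphic_intros) auto
    show "norm (\<Phi> w) \<le> 2" if "norm w = 1" for w
    proof -
      have "norm (\<Phi> w) \<le> 1 + norm (exp (- (of_nat N * H w)))"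
        unfolding \<Phi>_def by (rule norm_triangle_le_diff) simp
      also have "norm (exp (- (of_nat N * H w))) \<le> 1"
        using ReH[OF that] by simp
      finally show ?thesis by simp
    qed
    show "norm (\<Phi> w - 1) \<le> 4 / real N" if w: "w \<in> E" for w
    proof -
      obtain b where b: "b \<in> B" "dist w b \<le> \<delta>" using EB[OF w] by blast
      have "1 / 4 \<le> Re (T b w)" using ReT' b nE[OF w] by blast
      also have "\<dots> \<le> Re (H w)"
        unfolding H_def Re_sum using B(1) b nE[OF w] ReT by (intro member_le_sum) auto
      finally have "real N * (1 / 4) \<le> real N * Re (H w)"
        by (intro mult_left_mono) auto
      then have "norm (\<Phi> w - 1) \<le> exp (- (real N / 4))"
        by (simp add: \<Phi>_def)
      also have "\<dots> \<le> inverse (real N / 4)"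
        unfolding exp_minus using N exp_ge_add_one_self[of "real N / 4"] by (intro le_imp_inverse_le) linarith+
      finally show ?thesis by simp
    qed
    show "norm (\<Phi> w) \<le> 3 / (real N * d)"
      if w: "norm w = 1" and d: "3 / real N \<le> d" "\<And>z. z \<in> E \<Longrightarrow> d \<le> dist w z" for w d
    proof -
      have "0 < 3 / real N"
        using N by simp
      then have dpos: "0 < 2 / 3 * d"
        using d(1) by linarith
      \<comment> \<open>The centre \<open>b\<close> is within \<delta> \<le> 1/N \<le> d/3 of
        \<open>E\<close>, so at least 2d/3 of the distance from \<open>w\<close> remains. Moving the
        pole outwards by \<delta> only enlarges the denominator.\<close>
      have "norm (T b w) \<le> \<delta> / (2 / 3 * d)" if b: "b \<in> B" for b
      proof -
        obtain z where z: "z \<in> E" "dist z b \<le> \<delta>" using BE[OF b] by blast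
        have "d \<le> dist w z" using d z by simp
        also have "\<dots> \<le> dist w b + \<delta>"
          using z(2) dist_triangle2[of w z b] by simp
        finally have "2 / 3 * d \<le> dist w b" using \<delta>(2) d(1) by simp
        also have "\<dots> = norm (1 - w * cnj b)" using diff[OF b] by simp
        also have "\<dots> \<le> norm (of_real (1 + \<delta>) - w * cnj b)"
        proof -
          have "Re (w * cnj b) \<le> norm (w * cnj b)" by (rule complex_Re_le_cmod)
          also have "\<dots> = 1" using b w B by (auto simp: norm_mult)
          finally have "(1 - Re (w * cnj b))\<^sup>2 \<le> (1 + \<delta> - Re (w * cnj b))\<^sup>2"
            using \<delta>(1) by (intro power_mono) auto
          then show ?thesis
            unfolding cmod_def by (intro real_sqrt_le_mono) (simp del: times_complex.sel)
        qed
        finally have "2 / 3 * d \<le> norm (of_real (1 + \<delta>) - w * cnj b)" .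
        then show ?thesis
          unfolding T_def norm_divide using \<delta> dpos by (intro frac_le) auto
      qed
      then have "norm (H w) \<le> real (card B) * (\<delta> / (2 / 3 * d))"
        unfolding H_def by (rule sum_norm_bound)
      also have "\<dots> = (real (card B) * \<delta>) / (2 / 3 * d)" by simp
      also have "\<dots> \<le> (1 / (real N)\<^sup>2) / (2 / 3 * d)"
        using dpos \<delta> by (intro divide_right_mono) auto
      finally have "real N * norm (H w) \<le> real N * ((1 / (real N)\<^sup>2) / (2 / 3 * d))"
        by (intro mult_left_mono) auto
      also have "\<dots> = 3 / 2 / (real N * d)"
        using N by (simp add: power2_eq_square)
      finally have le: "norm (- (of_nat N * H w)) \<le> 3 / 2 / (real N * d)"
        by (simp add: norm_mult)
      \<comment> \<open>The hypothesis 3/N \<le> d keeps the exponent within norm 1/2, as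
        \<open>norm_exp_bounds\<close> requires; the resulting constant 9/4 is rounded up to
        3.\<close>
      have "3 / 2 / (real N * d) \<le> 1 / 2"
        using d(1) N dpos by (simp add: field_simps)
      then have "norm (exp (- (of_nat N * H w)) - 1) \<le> 3 / 2 * norm (- (of_nat N * H w))"
        using le by (intro norm_exp_bounds) linarith
      also have "\<dots> \<le> 3 / 2 * (3 / 2 / (real N * d))"
        using le by (intro mult_left_mono) auto
      also have "\<dots> \<le> 3 / (real N * d)"
        using N dpos by (simp add: field_simps)
      finally show ?thesis
        unfolding \<Phi>_def by (simp add: norm_minus_commute)
    qed
  qed
qed

subsection \<open>Measures with square summable one-sided Fourier coefficients\<close>

text \<open>Under the parametrisation \<open>cis (- 2 * pi * y)\<close> this becomes normalised arc
  length on the circle.\<close>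

abbreviation unit_lebesgue :: "real measure" where
  "unit_lebesgue \<equiv> restrict_space lborel {0..1}"

lemma finite_measure_unit_lebesgue: "finite_measure unit_lebesgue"
  by (rule finite_measureI) (simp add: space_restrict_space emeasure_restrict_space)

lemma borel_measurable_unit_lebesgue:
  "f \<in> borel_measurable borel \<Longrightarrow> f \<in> borel_measurable unit_lebesgue"
  by (rule measurable_restrict_space1) simp

lemma integral_unit_lebesgue_cis: "(\<integral>y. cis (2 * pi * (of_int m * y)) \<partial>unit_lebesgue) = of_bool (m = 0)"
proof (cases "m = 0")
  case True
  then show ?thesis
    by (simp add: measure_restrict_space space_restrict_space)
next
  case False
  define c where "c = \<i> * of_real (2 * pi * of_int m)"
  have c: "c \<noteq> 0" using False by (simp add: c_def)
  have cis: "cis (2 * pi * (of_int m * y)) = exp (c * of_real y)" for y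
    by (simp add: cis_conv_exp c_def mult.assoc)
  have "has_bochner_integral lborel (\<lambda>y. indicator {0..1} y *\<^sub>R exp (c * of_real y))
      (exp (c * of_real 1) / c - exp (c * of_real 0) / c)"
  proof (rule has_bochner_integral_FTC_Icc)
    show "((\<lambda>y. exp (c * of_real y) / c) has_vector_derivative exp (c * of_real y)) (at y within {0..1})" for y
      using c by (auto intro!: derivative_eq_intros has_vector_derivative_real_field)
  qed (auto intro!: continuous_intros)
  moreover have "exp (c * of_real 1) = 1"
    using cis[of 1] cis_multiple_2pi[of "of_int m"] by (simp add: mult.commute)
  ultimately show ?thesis
    using False by (simp add: cis integral_restrict_space has_bochner_integral_integral_eq)
qed

lemma parseval_trigonometric_polynomial:
  fixes a :: "nat \<Rightarrow> complex"
  shows "(\<integral>y. (norm (\<Sum>k<n. a k * cis (- 2 * pi * y) ^ k))\<^sup>2 \<partial>unit_lebesgue) = (\<Sum>k<n. (norm (a k))\<^sup>2)"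
proof -
  interpret finite_measure unit_lebesgue by (rule finite_measure_unit_lebesgue)
  \<comment> \<open>The difference of indices is taken in the integers, since subtraction of
    naturals would truncate.\<close>
  let ?e = "\<lambda>j k y. cis (2 * pi * (of_int (int k - int j) * y))"
  have e: "integrable unit_lebesgue (\<lambda>y. c * ?e j k y)" for c j k
    by (intro integrable_mult_right integrable_const_bound[where B = 1])
       (auto intro!: borel_measurable_unit_lebesgue borel_measurable_continuous_onI continuous_intros)
  have "complex_of_real ((norm (\<Sum>k<n. a k * cis (- 2 * pi * y) ^ k))\<^sup>2) =
      (\<Sum>j<n. \<Sum>k<n. a j * cnj (a k) * ?e j k y)" for y
    unfolding complex_norm_square cnj_sum sum_product
    by (intro sum.cong) (auto simp: Complex.DeMoivre cis_cnj cis_mult algebra_simps)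
  then have "complex_of_real (\<integral>y. (norm (\<Sum>k<n. a k * cis (- 2 * pi * y) ^ k))\<^sup>2 \<partial>unit_lebesgue) =
      (\<integral>y. (\<Sum>j<n. \<Sum>k<n. a j * cnj (a k) * ?e j k y) \<partial>unit_lebesgue)"
    by (simp only: integral_complex_of_real[symmetric])
  also have "\<dots> = (\<Sum>j<n. \<Sum>k<n. a j * cnj (a k) * (\<integral>y. ?e j k y \<partial>unit_lebesgue))"
    using e by (subst Bochner_Integration.integral_sum
        | intro Bochner_Integration.integrable_sum sum.cong refl | simp)+
  also have "\<dots> = (\<Sum>j<n. \<Sum>k<n. if k = j then of_real ((norm (a j))\<^sup>2) else 0)"
    unfolding integral_unit_lebesgue_cis complex_norm_square by (intro sum.cong) auto
  also have "\<dots> = of_real (\<Sum>k<n. (norm (a k))\<^sup>2)"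
    by simp
  finally show ?thesis
    unfolding of_real_eq_iff .
qed

text \<open>The Taylor series of \<Phi> has only nonnegative powers, so the integral against
  \<open>G\<close> is the limit of the sums of a_k c_k and never involves coefficients of negative
  index. Cauchy-Schwarz separates the two factors, and Parseval identifies the first with the mean
  square of \<Phi> on the circle.\<close>

lemma norm_integral_disc_function_le:
  fixes G :: "'a \<Rightarrow> complex" and p :: "'a \<Rightarrow> real" and c :: "nat \<Rightarrow> complex"
  assumes \<Phi>: "\<Phi> holomorphic_on ball 0 r" "r > 1"
    and p: "p \<in> borel_measurable M" and G: "integrable M G"
    and c: "\<And>k. c k = (\<integral>x. cis (- 2 * pi * (real k * p x)) * G x \<partial>M)"
    and sum: "summable (\<lambda>k. (norm (c k))\<^sup>2)"
  shows "(norm (\<integral>x. \<Phi> (cis (- 2 * pi * p x)) * G x \<partial>M))\<^sup>2 \<le>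
    (\<integral>y. (norm (\<Phi> (cis (- 2 * pi * y))))\<^sup>2 \<partial>unit_lebesgue) * (\<Sum>k. (norm (c k))\<^sup>2)"
proof -
  interpret finite_measure unit_lebesgue by (rule finite_measure_unit_lebesgue)
  define a where "a k = (deriv ^^ k) \<Phi> 0 / fact k" for k
  have sums: "(\<lambda>k. a k * w ^ k) sums \<Phi> w" if "norm w < r" for w
    using holomorphic_power_series[OF \<Phi>(1), of w] that by (simp add: a_def)
  \<comment> \<open>A radius strictly between 1 and \<open>r\<close>: convergence there gives
    absolute convergence on the unit circle, hence a common bound for all partial sums in the
    dominated convergence arguments.\<close>
  define \<rho> where "\<rho> = (1 + r) / 2"
  have \<rho>: "1 < norm (of_real \<rho> :: complex)" "norm (of_real \<rho> :: complex) < r"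
    using \<open>r > 1\<close> by (auto simp: \<rho>_def norm_of_real abs_if simp del: of_real_divide of_real_add)
  have "summable (\<lambda>k. norm (a k * 1 ^ k))"
    using powser_insidea[OF sums_summable[OF sums[OF \<rho>(2)]], of 1] \<rho>(1) by simp
  then have abs_sum: "summable (\<lambda>k. norm (a k))" by simp
  define S where "S n w = (\<Sum>k<n. a k * w ^ k)" for n w
  have S_le: "norm (S n w) \<le> (\<Sum>k. norm (a k))" if "norm w = 1" for n w
  proof -
    have "norm (S n w) \<le> (\<Sum>k<n. norm (a k))"
      unfolding S_def by (intro sum_norm_le) (simp add: norm_mult norm_power that)
    also have "\<dots> \<le> (\<Sum>k. norm (a k))"
      by (intro sum_le_suminf abs_sum) auto
    finally show ?thesis .
  qed
  have S_lim: "(\<lambda>n. S n w) \<longlonglongrightarrow> \<Phi> w" if "norm w = 1" for w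
    using sums[of w] \<open>r > 1\<close> that by (simp add: S_def sums_def)
  have S_meas: "(\<lambda>y. S n (cis (- 2 * pi * y))) \<in> borel_measurable borel" for n
    unfolding S_def by (intro borel_measurable_continuous_onI continuous_intros)
  have lim1: "(\<lambda>n. \<integral>x. S n (cis (- 2 * pi * p x)) * G x \<partial>M) \<longlonglongrightarrow> (\<integral>x. \<Phi> (cis (- 2 * pi * p x)) * G x \<partial>M)"
  proof (rule tendsto_integral_bounded_mult[where C = "\<Sum>k. norm (a k)", OF _ _ _ G])
    show "(\<lambda>x. S n (cis (- 2 * pi * p x))) \<in> borel_measurable M" for n
      using measurable_compose[OF p S_meas] .
  qed (use S_le S_lim in auto)
  have lim2: "(\<lambda>n. \<integral>y. (norm (S n (cis (- 2 * pi * y))))\<^sup>2 \<partial>unit_lebesgue) \<longlonglongrightarrow>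
      (\<integral>y. (norm (\<Phi> (cis (- 2 * pi * y))))\<^sup>2 \<partial>unit_lebesgue)"
  proof (rule integral_dominated_convergence[where w = "\<lambda>_. (\<Sum>k. norm (a k))\<^sup>2"])
    have "(\<lambda>y. \<Phi> (cis (- 2 * pi * y))) \<in> borel_measurable borel"
      by (rule borel_measurable_LIMSEQ_metric[OF S_meas S_lim]) simp
    then show "(\<lambda>y. (norm (\<Phi> (cis (- 2 * pi * y))))\<^sup>2) \<in> borel_measurable unit_lebesgue"
      by (intro borel_measurable_unit_lebesgue borel_measurable_power measurable_compose[OF _ borel_measurable_norm])
    show "(\<lambda>y. (norm (S n (cis (- 2 * pi * y))))\<^sup>2) \<in> borel_measurable unit_lebesgue" for n
      by (intro borel_measurable_unit_lebesgue borel_measurable_power measurable_compose[OF _ borel_measurable_norm] S_meas)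
    show "AE y in unit_lebesgue. (\<lambda>n. (norm (S n (cis (- 2 * pi * y))))\<^sup>2) \<longlonglongrightarrow> (norm (\<Phi> (cis (- 2 * pi * y))))\<^sup>2"
      by (intro AE_I2 tendsto_intros S_lim) simp
    show "AE y in unit_lebesgue. norm ((norm (S n (cis (- 2 * pi * y))))\<^sup>2) \<le> (\<Sum>k. norm (a k))\<^sup>2" for n
      by (intro AE_I2) (auto intro!: power_mono S_le)
  qed simp
  have le: "(norm (\<integral>x. S n (cis (- 2 * pi * p x)) * G x \<partial>M))\<^sup>2 \<le>
      (\<integral>y. (norm (S n (cis (- 2 * pi * y))))\<^sup>2 \<partial>unit_lebesgue) * (\<Sum>k. (norm (c k))\<^sup>2)" for n
  proof -
    have int: "integrable M (\<lambda>x. cis (- 2 * pi * (real k * p x)) * G x)" for k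
    proof (rule integrable_bounded_mult[where C = 1, OF _ _ G])
      have "(\<lambda>y. cis (- 2 * pi * (real k * y))) \<in> borel_measurable borel"
        by (intro borel_measurable_continuous_onI continuous_intros)
      then show "(\<lambda>x. cis (- 2 * pi * (real k * p x))) \<in> borel_measurable M"
        by (rule measurable_compose[OF p])
    qed simp
    have "S n (cis (- 2 * pi * p x)) * G x = (\<Sum>k<n. a k * (cis (- 2 * pi * (real k * p x)) * G x))" for x
      unfolding S_def sum_distrib_right by (intro sum.cong) (simp_all add: Complex.DeMoivre mult_ac)
    then have "(\<integral>x. S n (cis (- 2 * pi * p x)) * G x \<partial>M) = (\<Sum>k<n. a k * c k)"
      using int by (simp add: c)
    then have "norm (\<integral>x. S n (cis (- 2 * pi * p x)) * G x \<partial>M) \<le> (\<Sum>k<n. norm (a k) * norm (c k))"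
      using norm_sum[of "\<lambda>k. a k * c k" "{..<n}"] by (simp add: norm_mult)
    then have "(norm (\<integral>x. S n (cis (- 2 * pi * p x)) * G x \<partial>M))\<^sup>2 \<le> (\<Sum>k<n. norm (a k) * norm (c k))\<^sup>2"
      by (intro power_mono) auto
    also have "\<dots> \<le> (\<Sum>k<n. (norm (a k))\<^sup>2) * (\<Sum>k<n. (norm (c k))\<^sup>2)"
      by (rule Cauchy_Schwarz_ineq_sum)
    also have "\<dots> \<le> (\<Sum>k<n. (norm (a k))\<^sup>2) * (\<Sum>k. (norm (c k))\<^sup>2)"
      by (intro mult_left_mono sum_le_suminf sum sum_nonneg) auto
    finally show ?thesis
      unfolding S_def parseval_trigonometric_polynomial .
  qed
  show ?thesis
    using le by (intro LIMSEQ_le[OF tendsto_power[OF tendsto_norm[OF lim1]] tendsto_mult_right[OF lim2]]) auto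
qed

text \<open>The parametrisation of the circle has period 1, so the preimage is covered by countably
  many integer translates of \<open>K\<close>.\<close>

lemma null_sets_circle_preimage:
  assumes "K \<in> null_sets lebesgue"
  shows "{y. cis (- 2 * pi * y) \<in> (\<lambda>y. cis (- 2 * pi * y)) ` K} \<in> null_sets lebesgue"
proof -
  have "{y. cis (- 2 * pi * y) \<in> (\<lambda>y. cis (- 2 * pi * y)) ` K} \<subseteq> (\<Union>m::int. (\<lambda>y. of_int m + y) ` K)"
  proof safe
    fix y z assume "cis (- 2 * pi * y) = cis (- 2 * pi * z)" "z \<in> K"
    moreover have "cis (- 2 * pi * (y - z)) = cis (- 2 * pi * y) / cis (- 2 * pi * z)"
      by (simp only: cis_divide right_diff_distrib)
    ultimately have "cis (- 2 * pi * (y - z)) = 1"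
      by simp
    then obtain m where "- 2 * pi * (y - z) = of_int (2 * m) * pi"
      by (auto simp: cis_conv_exp exp_eq_1)
    then have "(2 * pi) * (z - y) = (2 * pi) * of_int m"
      by (simp add: algebra_simps)
    then have "y = of_int (- m) + z"
      by simp
    with \<open>z \<in> K\<close> show "y \<in> (\<Union>m::int. (\<lambda>y. of_int m + y) ` K)"
      by blast
  qed
  moreover have "negligible (\<Union>m::int. (\<lambda>y. of_int m + y) ` K)"
    using assms by (intro negligible_countable_Union) (auto simp: negligible_iff_null_sets[symmetric] negligible_translation)
  ultimately show ?thesis
    using negligible_iff_null_sets negligible_subset by blast
qed

text \<open>A variant of the theorem of F. and M. Riesz for the image of the measure on the circle;
  only the Fourier coefficients of nonnegative index are controlled.\<close>
lemma integral_indicator_circle_null_eq_0: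
  fixes G :: "'a \<Rightarrow> complex" and p :: "'a \<Rightarrow> real" and K :: "real set"
  defines "E \<equiv> (\<lambda>y. cis (- 2 * pi * y)) ` K"
  assumes K: "compact K" "K \<in> null_sets lebesgue"
    and p: "p \<in> borel_measurable M" and G: "integrable M G"
    and sum: "summable (\<lambda>k. (norm (\<integral>x. cis (- 2 * pi * (real k * p x)) * G x \<partial>M))\<^sup>2)"
  shows "(\<integral>x. indicator E (cis (- 2 * pi * p x)) * G x \<partial>M) = 0"
proof -
  interpret finite_measure unit_lebesgue by (rule finite_measure_unit_lebesgue)
  have "\<exists>\<Phi> r. r > 1 \<and> \<Phi> holomorphic_on ball 0 r \<and> (\<forall>w. norm w = 1 \<longrightarrow> norm (\<Phi> w) \<le> 2) \<and>
      (\<forall>w. w \<in> E \<longrightarrow> norm (\<Phi> w - 1) \<le> 4 / real (Suc n)) \<and>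
      (\<forall>w d. norm w = 1 \<longrightarrow> 3 / real (Suc n) \<le> d \<longrightarrow> (\<forall>z. z \<in> E \<longrightarrow> d \<le> dist w z) \<longrightarrow>
         norm (\<Phi> w) \<le> 3 / (real (Suc n) * d))" for n
    using circle_peak_function[OF K, of "Suc n"] unfolding E_def by (metis zero_less_Suc)
  then obtain \<Phi> r where \<Phi>: "\<And>n. r n > 1" "\<And>n. \<Phi> n holomorphic_on ball 0 (r n)"
      "\<And>n w. norm w = 1 \<Longrightarrow> norm (\<Phi> n w) \<le> 2"
      "\<And>n w. w \<in> E \<Longrightarrow> norm (\<Phi> n w - 1) \<le> 4 / real (Suc n)"
      "\<And>n w d. norm w = 1 \<Longrightarrow> 3 / real (Suc n) \<le> d \<Longrightarrow> (\<And>z. z \<in> E \<Longrightarrow> d \<le> dist w z) \<Longrightarrow>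
         norm (\<Phi> n w) \<le> 3 / (real (Suc n) * d)"
    by metis
  have inv: "(\<lambda>n. 1 / real (Suc n)) \<longlonglongrightarrow> 0"
    by (rule LIMSEQ_Suc[OF lim_1_over_n])
  have \<Phi>_lim: "(\<lambda>n. \<Phi> n w) \<longlonglongrightarrow> indicator E w" if w: "norm w = 1" for w
  proof (cases "w \<in> E")
    case True
    have "(\<lambda>n. 4 * (1 / real (Suc n))) \<longlonglongrightarrow> 0"
      by (rule tendsto_mult_right_zero[OF inv])
    then have "(\<lambda>n. \<Phi> n w - 1) \<longlonglongrightarrow> 0"
      by (rule Lim_null_comparison[rotated]) (use \<Phi>(4)[OF True] in simp)
    then show ?thesis
      using True by (simp add: LIM_zero_iff)
  next
    case False
    \<comment> \<open>Compactness gives \<open>w\<close> a positive distance \<open>d\<close> from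
      \<open>E\<close>; the decay estimate applies as soon as 3/(n+1) \<le> d.\<close>
    have "compact E"
      unfolding E_def by (intro compact_continuous_image K continuous_intros)
    then obtain d where d: "d > 0" "\<And>z. z \<in> E \<Longrightarrow> d \<le> dist w z"
      using separate_point_closed[OF _ False] compact_imp_closed by blast
    have "\<forall>\<^sub>F n in sequentially. 1 / real (Suc n) < d / 3"
      using order_tendstoD(2)[OF inv, of "d / 3"] d(1) by simp
    then have "\<forall>\<^sub>F n in sequentially. norm (\<Phi> n w) \<le> 3 / d * (1 / real (Suc n))"
    proof eventually_elim
      case (elim n)
      then show ?case using \<Phi>(5)[OF w _ d(2), of n] by (simp add: mult.commute)
    qed
    then have "(\<lambda>n. \<Phi> n w) \<longlonglongrightarrow> 0"
      by (rule Lim_null_comparison) (rule tendsto_mult_right_zero[OF inv])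
    then show ?thesis
      using False by simp
  qed
  have \<Phi>_meas: "(\<lambda>y. \<Phi> n (cis (- 2 * pi * y))) \<in> borel_measurable borel" for n
  proof (rule borel_measurable_continuous_onI,
      rule continuous_on_compose2[OF holomorphic_on_imp_continuous_on[OF \<Phi>(2)]])
    show "continuous_on UNIV (\<lambda>y. cis (- 2 * pi * y))"
      by (intro continuous_intros)
    show "range (\<lambda>y. cis (- 2 * pi * y)) \<subseteq> ball 0 (r n)"
      using \<Phi>(1)[of n] by (auto simp: dist_norm)
  qed
  have lim1: "(\<lambda>n. \<integral>x. \<Phi> n (cis (- 2 * pi * p x)) * G x \<partial>M) \<longlonglongrightarrow>
      (\<integral>x. indicator E (cis (- 2 * pi * p x)) * G x \<partial>M)"
  proof (rule tendsto_integral_bounded_mult[where C = 2, OF _ _ _ G])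
    show "(\<lambda>x. \<Phi> n (cis (- 2 * pi * p x))) \<in> borel_measurable M" for n
      using measurable_compose[OF p \<Phi>_meas] .
  qed (use \<Phi>(3) \<Phi>_lim in auto)
  have ind_meas: "(\<lambda>y. indicator E (cis (- 2 * pi * y)) :: complex) \<in> borel_measurable borel"
    by (rule borel_measurable_LIMSEQ_metric[OF \<Phi>_meas \<Phi>_lim]) simp
  have "(\<lambda>n. \<integral>y. (norm (\<Phi> n (cis (- 2 * pi * y))))\<^sup>2 \<partial>unit_lebesgue) \<longlonglongrightarrow>
      (\<integral>y. (norm (indicator E (cis (- 2 * pi * y)) :: complex))\<^sup>2 \<partial>unit_lebesgue)"
  proof (rule integral_dominated_convergence[where w = "\<lambda>_. 2\<^sup>2"])
    show "(\<lambda>y. (norm (indicator E (cis (- 2 * pi * y)) :: complex))\<^sup>2) \<in> borel_measurable unit_lebesgue"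
      by (intro borel_measurable_unit_lebesgue borel_measurable_power measurable_compose[OF _ borel_measurable_norm] ind_meas)
    show "(\<lambda>y. (norm (\<Phi> n (cis (- 2 * pi * y))))\<^sup>2) \<in> borel_measurable unit_lebesgue" for n
      by (intro borel_measurable_unit_lebesgue borel_measurable_power measurable_compose[OF _ borel_measurable_norm] \<Phi>_meas)
    show "AE y in unit_lebesgue. (\<lambda>n. (norm (\<Phi> n (cis (- 2 * pi * y))))\<^sup>2) \<longlonglongrightarrow>
        (norm (indicator E (cis (- 2 * pi * y)) :: complex))\<^sup>2"
      by (intro AE_I2 tendsto_intros \<Phi>_lim) simp
    show "AE y in unit_lebesgue. norm ((norm (\<Phi> n (cis (- 2 * pi * y))))\<^sup>2) \<le> 2\<^sup>2" for n
      unfolding real_norm_def abs_power2 by (intro AE_I2 power_mono \<Phi>(3)) auto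
  qed simp
  moreover have "(\<integral>y. (norm (indicator E (cis (- 2 * pi * y)) :: complex))\<^sup>2 \<partial>unit_lebesgue) = 0"
  proof (rule integral_eq_zero_AE)
    have "AE y in lborel. y \<notin> {y. cis (- 2 * pi * y) \<in> E}"
      using AE_not_in[OF null_sets_circle_preimage[OF K(2)]] unfolding E_def by (simp add: AE_completion_iff)
    then have "AE y in unit_lebesgue. y \<notin> {y. cis (- 2 * pi * y) \<in> E}"
      by (subst AE_restrict_space_iff) auto
    then show "AE y in unit_lebesgue. (norm (indicator E (cis (- 2 * pi * y)) :: complex))\<^sup>2 = 0"
      by eventually_elim simp
  qed
  ultimately have lim2: "(\<lambda>n. \<integral>y. (norm (\<Phi> n (cis (- 2 * pi * y))))\<^sup>2 \<partial>unit_lebesgue) \<longlonglongrightarrow> 0"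
    by simp
  \<comment> \<open>The sum of squared coefficients stays fixed while the mean square of the peak
    functions tends to 0.\<close>
  have "(norm (\<integral>x. indicator E (cis (- 2 * pi * p x)) * G x \<partial>M))\<^sup>2 \<le> 0"
    by (rule LIMSEQ_le[OF tendsto_power[OF tendsto_norm[OF lim1]] tendsto_mult_left_zero[OF lim2]])
       (use norm_integral_disc_function_le[OF \<Phi>(2,1) p G refl sum] in blast)
  then show ?thesis by simp
qed

subsection \<open>Measures with Fourier transform in a bundle\<close>

text \<open>The Hermitian product, antilinear in the first argument so that \<open>cinner w\<close>
  is complex linear and passes through the Fourier integral. The built-in inner product is only its
  real part.\<close>

definition cinner :: "complex ^ 'm \<Rightarrow> complex ^ 'm \<Rightarrow> complex" where
  "cinner w z = (\<Sum>i\<in>UNIV. cnj (w $ i) * z $ i)"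

lemma Re_cinner: "Re (cinner w z) = w \<bullet> z"
  by (simp add: cinner_def inner_vec_def inner_complex_def)

lemma cinner_scale: "cinner w (c *s z) = c * cinner w z"
  by (simp add: cinner_def sum_distrib_left mult_ac)

lemma bounded_linear_cinner: "bounded_linear (cinner w)"
proof -
  have "linear (cinner w)"
    by (rule linearI) (simp_all add: cinner_def distrib_left sum.distrib scaleR_sum_right)
  then show ?thesis
    by (simp add: linear_conv_bounded_linear)
qed

lemma norm_vector_scale: "norm (c *s z) = norm c * norm (z :: complex ^ 'm)"
  by (simp add: norm_vec_def L2_set_def norm_mult power_mult_distrib sum_distrib_left[symmetric]
      real_sqrt_mult)

lemma vec_subspace_imp_subspace:
  fixes V :: "(complex ^ 'm) set"
  assumes "vec.subspace V"
  shows "subspace V"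
proof (rule subspaceI)
  have scale: "c *\<^sub>R x = complex_of_real c *s x" for c and x :: "complex ^ 'm"
    unfolding vec_eq_iff vector_scaleR_component vector_smult_component by (simp add: scaleR_conv_of_real)
  show "c *\<^sub>R x \<in> V" if "x \<in> V" for c x
    unfolding scale using that assms by (rule vec.subspace_scale[rotated])
qed (use assms in \<open>auto intro: vec.subspace_0 vec.subspace_add\<close>)

text \<open>\<open>onorm\<close> is a supremum of reals and bounds its quotients only if these are
  bounded above. Projections are nonexpansive and fix 0, so 2 is such a bound.\<close>

lemma norm_closest_point_diff_le:
  assumes "vec.subspace V" "vec.subspace W"
  shows "norm (closest_point V x - closest_point W x) \<le> grass_dist V W * norm x"
proof (cases "x = 0")
  case True
  then show ?thesis
    using assms by (simp add: closest_point_self vec.subspace_0)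
next
  case False
  have le: "norm (closest_point S y) \<le> norm y" if "vec.subspace S" for S :: "(complex ^ 'm) set" and y
  proof -
    have S: "subspace S" using that by (rule vec_subspace_imp_subspace)
    then have "dist (closest_point S y) (closest_point S 0) \<le> dist y 0"
      by (intro closest_point_lipschitz subspace_imp_convex closed_subspace) (auto dest: subspace_0)
    then show ?thesis
      using S by (simp add: closest_point_self subspace_0)
  qed
  have bdd: "bdd_above (range (\<lambda>y. norm (closest_point V y - closest_point W y) / norm y))"
  proof (rule bdd_aboveI2)
    fix y
    have "norm (closest_point V y - closest_point W y) \<le> norm y + norm y"
      using le[OF assms(1), of y] le[OF assms(2), of y] by (intro norm_triangle_le_diff add_mono)
    then show "norm (closest_point V y - closest_point W y) / norm y \<le> 2"
      by (cases "y = 0") (simp_all add: divide_le_eq)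
  qed
  have "norm (closest_point V x - closest_point W x) / norm x \<le> grass_dist V W"
    unfolding grass_dist_def onorm_def by (rule cSUP_upper[OF UNIV_I bdd])
  then show ?thesis
    using False by (simp add: divide_le_eq)
qed

text \<open>A phase rotation inside the complex subspace \<open>V\<close> makes the product real and
  nonnegative, so the real inner product suffices. The rotated vector is its own projection to
  \<open>V\<close>, and its projection to \<open>W\<close> is orthogonal to \<open>w\<close>; the
  difference of projections remains.\<close>

lemma norm_cinner_le_grass_dist:
  assumes V: "vec.subspace V" and W: "vec.subspace W" and z: "z \<in> V"
    and w: "\<And>y. y \<in> W \<Longrightarrow> w \<bullet> y = 0"
  shows "norm (cinner w z) \<le> grass_dist V W * norm z * norm w"
proof -
  define u where "u = cis (- Arg (cinner w z)) *s z"
  have u: "u \<in> V" "norm u = norm z"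
    using V z by (auto simp: u_def norm_vector_scale vec.subspace_scale)
  have "cinner w z = of_real (norm (cinner w z)) * cis (Arg (cinner w z))"
    using rcis_cmod_Arg[of "cinner w z"] by (simp add: rcis_def)
  then have "cinner w u = of_real (norm (cinner w z))"
    unfolding u_def cinner_scale
    by (metis (no_types, lifting) cis_mult add.left_inverse cis_zero mult.left_commute mult.right_neutral)
  then have "norm (cinner w z) = w \<bullet> u"
    using Re_cinner[of w u] by simp
  also have "\<dots> = w \<bullet> (closest_point V u - closest_point W u)"
    using u(1) w[of "closest_point W u"] closest_point_in_set[of W u] W
    by (auto simp: closest_point_self inner_diff_right closed_subspace vec_subspace_imp_subspace dest: vec.subspace_0)
  also have "\<dots> \<le> norm w * norm (closest_point V u - closest_point W u)"
    by (rule norm_cauchy_schwarz)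
  also have "\<dots> \<le> norm w * (grass_dist V W * norm u)"
    by (intro mult_left_mono norm_closest_point_diff_le V W) auto
  finally show ?thesis
    by (simp add: u(2) mult_ac)
qed

text \<open>Compare both points with \<eta> / t: the perturbation and the change of norm each
  contribute at most norm \<xi> / t.\<close>

lemma dist_normalize_le:
  fixes v \<xi> :: "'a::real_normed_vector"
  assumes v: "norm v = 1" and t: "norm \<xi> < t"
  defines "\<eta> \<equiv> t *\<^sub>R v + \<xi>"
  shows "\<eta> \<noteq> 0" "dist (\<eta> /\<^sub>R norm \<eta>) v \<le> 2 * norm \<xi> / t"
proof -
  have t0: "t > 0"
    using t norm_ge_zero[of \<xi>] by linarith
  have near: "\<bar>norm \<eta> - t\<bar> \<le> norm \<xi>"
    using norm_triangle_ineq3[of \<eta> "t *\<^sub>R v"] v t0 by (simp add: \<eta>_def)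
  then have pos: "norm \<eta> > 0"
    using t by linarith
  then show "\<eta> \<noteq> 0" by auto
  have "dist (\<eta> /\<^sub>R norm \<eta>) v \<le> norm (\<eta> /\<^sub>R norm \<eta> - \<eta> /\<^sub>R t) + norm (\<eta> /\<^sub>R t - v)"
    using norm_triangle_ineq[of "\<eta> /\<^sub>R norm \<eta> - \<eta> /\<^sub>R t" "\<eta> /\<^sub>R t - v"] by (simp add: dist_norm)
  also have "\<eta> /\<^sub>R t - v = \<xi> /\<^sub>R t"
    using t0 by (simp add: \<eta>_def scaleR_add_right)
  also have "norm (\<eta> /\<^sub>R norm \<eta> - \<eta> /\<^sub>R t) = \<bar>norm \<eta> - t\<bar> / t"
  proof -
    have "\<eta> /\<^sub>R norm \<eta> - \<eta> /\<^sub>R t = (inverse (norm \<eta>) - inverse t) *\<^sub>R \<eta>"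
      by (simp add: scaleR_diff_left)
    then have "norm (\<eta> /\<^sub>R norm \<eta> - \<eta> /\<^sub>R t) = \<bar>(inverse (norm \<eta>) - inverse t) * norm \<eta>\<bar>"
      by (simp add: abs_mult)
    also have "(inverse (norm \<eta>) - inverse t) * norm \<eta> = (t - norm \<eta>) / t"
      using pos t0 by (simp add: field_simps)
    finally show ?thesis
      using t0 by (simp add: abs_minus_commute)
  qed
  also have "\<dots> + norm (\<xi> /\<^sub>R t) \<le> norm \<xi> / t + norm \<xi> / t"
    using near t0 by (intro add_mono divide_right_mono) (auto simp: divide_inverse)
  finally show "dist (\<eta> /\<^sub>R norm \<eta>) v \<le> 2 * norm \<xi> / t"
    by simp
qed

lemma holder_bundle_dist_le:
  assumes hom: "homogeneous_bundle k \<phi>" and hol: "holder_on_sphere \<alpha> \<phi>" and \<alpha>: "\<alpha> \<ge> 0"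
  obtains C where "C \<ge> 0" "\<And>v \<xi> t. norm v = 1 \<Longrightarrow> norm \<xi> < t \<Longrightarrow>
    grass_dist (\<phi> (t *\<^sub>R v + \<xi>)) (\<phi> v) \<le> C * (2 * norm \<xi> / t) powr \<alpha>"
proof -
  obtain C where C: "\<And>u v. u \<in> sphere 0 1 \<Longrightarrow> v \<in> sphere 0 1 \<Longrightarrow>
      grass_dist (\<phi> u) (\<phi> v) \<le> C * dist u v powr \<alpha>"
    using hol unfolding holder_on_sphere_def by blast
  have "grass_dist (\<phi> (t *\<^sub>R v + \<xi>)) (\<phi> v) \<le> \<bar>C\<bar> * (2 * norm \<xi> / t) powr \<alpha>"
    if v: "norm v = 1" and t: "norm \<xi> < t" for v \<xi> t
  proof -
    define \<eta> where "\<eta> = t *\<^sub>R v + \<xi>"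
    have \<eta>: "\<eta> \<noteq> 0" and le: "dist (\<eta> /\<^sub>R norm \<eta>) v \<le> 2 * norm \<xi> / t"
      using dist_normalize_le[OF v t] by (auto simp: \<eta>_def)
    have "\<phi> \<eta> = \<phi> (\<eta> /\<^sub>R norm \<eta>)"
      using hom \<eta> unfolding homogeneous_bundle_def by simp
    also have "grass_dist \<dots> (\<phi> v) \<le> C * dist (\<eta> /\<^sub>R norm \<eta>) v powr \<alpha>"
      using \<eta> v by (intro C) auto
    \<comment> \<open>The Hoelder constant comes without a sign, so its absolute value is used
      before enlarging the other factor.\<close>
    also have "\<dots> \<le> \<bar>C\<bar> * dist (\<eta> /\<^sub>R norm \<eta>) v powr \<alpha>"
      by (intro mult_right_mono) auto
    also have "\<dots> \<le> \<bar>C\<bar> * (2 * norm \<xi> / t) powr \<alpha>"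
      using le \<alpha> by (intro mult_left_mono powr_mono2) auto
    finally show ?thesis by (simp add: \<eta>_def)
  qed
  then show ?thesis
    by (intro that[of "\<bar>C\<bar>"]) auto
qed

lemma fourier_cinner:
  assumes f: "integrable \<nu> f" and sets: "sets \<nu> = sets borel"
  shows "(\<integral>x. character \<xi> x * cinner w (f x) \<partial>\<nu>) = cinner w (vfourier \<nu> f \<xi>)"
    "norm (vfourier \<nu> f \<xi>) \<le> (\<integral>x. norm (f x) \<partial>\<nu>)"
proof -
  have meas: "(\<lambda>x. character \<xi> x *s f x) \<in> borel_measurable \<nu>"
  proof -
    have [measurable]: "f \<in> borel_measurable \<nu>" "character \<xi> \<in> borel_measurable \<nu>"
      using f sets by (auto simp: measurable_cong_sets[OF sets refl])
    have "continuous_on UNIV (\<lambda>p. fst p *s (snd p :: complex ^ 'b))"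
      unfolding vector_scalar_mult_def by (intro continuous_intros)
    then have "(\<lambda>p. fst p *s (snd p :: complex ^ 'b)) \<in> borel_measurable (borel \<Otimes>\<^sub>M borel)"
      by (simp add: borel_prod borel_measurable_continuous_onI)
    then have "(\<lambda>x. (\<lambda>p. fst p *s (snd p :: complex ^ 'b)) (character \<xi> x, f x)) \<in> borel_measurable \<nu>"
      by (rule measurable_compose[rotated]) measurable
    then show ?thesis by simp
  qed
  have int: "integrable \<nu> (\<lambda>x. character \<xi> x *s f x)"
    by (rule Bochner_Integration.integrable_bound[OF f meas]) (simp add: norm_vector_scale)
  have eq: "vfourier \<nu> f \<xi> = (\<integral>x. character \<xi> x *s f x \<partial>\<nu>)"
    by (simp add: vfourier_def character_def)
  show "(\<integral>x. character \<xi> x * cinner w (f x) \<partial>\<nu>) = cinner w (vfourier \<nu> f \<xi>)"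
    unfolding eq using integral_bounded_linear[OF bounded_linear_cinner int, of w]
    by (simp add: cinner_scale)
  show "norm (vfourier \<nu> f \<xi>) \<le> (\<integral>x. norm (f x) \<partial>\<nu>)"
    unfolding eq using integral_norm_bound[of \<nu> "\<lambda>x. character \<xi> x *s f x"] by (simp add: norm_vector_scale)
qed

text \<open>By inner regularity some countable union of compact subsets exhausts \<open>A\<close> up
  to a null set. These subsets need not increase, so the limit runs over their finite unions, which
  are again compact.\<close>

lemma integral_indicator_eq_0_compact_imp:
  fixes g :: "'a::{second_countable_topology, complete_space} \<Rightarrow> complex"
  assumes sets: "sets \<nu> = sets borel" and "finite_measure \<nu>" and g: "integrable \<nu> g" and A: "A \<in> sets borel"
    and 0: "\<And>K. compact K \<Longrightarrow> K \<subseteq> A \<Longrightarrow> (\<integral>x. indicator K x * g x \<partial>\<nu>) = 0"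
  shows "(\<integral>x. indicator A x * g x \<partial>\<nu>) = 0"
proof -
  interpret finite_measure \<nu> by fact
  let ?\<K> = "{K. K \<subseteq> A \<and> compact K}"
  have "?\<K> \<noteq> {}" by auto
  then obtain m :: "nat \<Rightarrow> ennreal" where m: "range m \<subseteq> emeasure \<nu> ` ?\<K>" "(SUP K\<in>?\<K>. emeasure \<nu> K) = (SUP i. m i)"
    using ennreal_Sup_countable_SUP[of "emeasure \<nu> ` ?\<K>"] by blast
  then have "\<forall>i. \<exists>K. K \<subseteq> A \<and> compact K \<and> m i = emeasure \<nu> K"
    by (auto simp: image_subset_iff image_iff)
  then obtain K where K: "\<And>i. K i \<subseteq> A" "\<And>i. compact (K i)" "\<And>i. m i = emeasure \<nu> (K i)"
    by metis
  define U where "U = (\<Union>i. K i)"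
  have K_sets: "K i \<in> sets \<nu>" for i
    using K(2) sets by (simp add: borel_compact)
  have A': "A \<in> sets \<nu>" and U: "U \<in> sets \<nu>" "U \<subseteq> A"
    using A sets K(1) K_sets by (auto simp: U_def)
  have "emeasure \<nu> A = (SUP i. emeasure \<nu> (K i))"
    using inner_regular[OF sets _ A] m(2) K(3) by simp
  also have "\<dots> \<le> emeasure \<nu> U"
    using U by (intro SUP_least emeasure_mono) (auto simp: U_def)
  finally have "emeasure \<nu> (A - U) = 0"
    using U A' emeasure_mono[OF U(2) A'] by (subst emeasure_Diff) (auto intro: diff_eq_0_ennreal)
  then have "AE x in \<nu>. x \<notin> A - U"
    using A' U by (intro AE_not_in null_setsI) auto
  then have "(\<integral>x. indicator A x * g x \<partial>\<nu>) = (\<integral>x. indicator U x * g x \<partial>\<nu>)"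
  proof (intro integral_cong_AE)
    show "(\<lambda>x. indicator A x * g x) \<in> borel_measurable \<nu>" "(\<lambda>x. indicator U x * g x) \<in> borel_measurable \<nu>"
      using A' U g by (auto intro!: borel_measurable_times borel_measurable_indicator)
    assume "AE x in \<nu>. x \<notin> A - U"
    then show "AE x in \<nu>. indicator A x * g x = indicator U x * g x"
      by eventually_elim (use U(2) in \<open>auto simp: indicator_def\<close>)
  qed
  also have "\<dots> = 0"
  proof -
    have "(\<lambda>n. \<integral>x. indicator (\<Union>i<n. K i) x * g x \<partial>\<nu>) \<longlonglongrightarrow> (\<integral>x. indicator U x * g x \<partial>\<nu>)"
    proof (rule tendsto_integral_bounded_mult[where C = 1, OF _ _ _ g])
      show "indicator (\<Union>i<n. K i) \<in> borel_measurable \<nu>" for n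
        using K_sets by (intro borel_measurable_indicator) auto
      show "(\<lambda>n. indicator (\<Union>i<n. K i) x) \<longlonglongrightarrow> (indicator U x :: complex)" for x
        unfolding U_def by (rule LIMSEQ_indicator_UN)
    qed (simp add: indicator_def)
    moreover have "(\<integral>x. indicator (\<Union>i<n. K i) x * g x \<partial>\<nu>) = 0" for n
      using K by (intro 0 compact_UN) auto
    ultimately show ?thesis
      by (simp add: LIMSEQ_const_iff)
  qed
  finally show ?thesis .
qed

text \<open>Pairing with \<open>w\<close>, orthogonal to the fibre at \<open>v\<close>, leaves only
  the distance of the fibre at j v + \<xi> from that at \<open>v\<close>, which is O(j^(-\<alpha>)).
  The squares are summable exactly because 2 \<alpha> > 1.\<close>

lemma summable_fourier_coefficients:
  assumes hom: "homogeneous_bundle k \<phi>" and \<alpha>: "\<alpha> > 1/2" and hol: "holder_on_sphere \<alpha> \<phi>"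
    and M: "in_M_phi \<phi> \<nu> f" and v: "norm v = 1" and w: "\<And>y. y \<in> \<phi> v \<Longrightarrow> w \<bullet> y = 0"
  shows "summable (\<lambda>j. (norm (\<integral>x. character (real j *\<^sub>R v + \<xi>) x * cinner w (f x) \<partial>\<nu>))\<^sup>2)"
proof -
  obtain C where C: "C \<ge> 0" "\<And>v \<xi> t. norm v = 1 \<Longrightarrow> norm \<xi> < t \<Longrightarrow>
      grass_dist (\<phi> (t *\<^sub>R v + \<xi>)) (\<phi> v) \<le> C * (2 * norm \<xi> / t) powr \<alpha>"
    using holder_bundle_dist_le[OF hom hol] \<alpha> by auto
  have sub: "vec.subspace (\<phi> \<eta>)" if "\<eta> \<noteq> 0" for \<eta>
    using hom that unfolding homogeneous_bundle_def grassmannian_def by blast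
  have v0: "v \<noteq> 0" using v by auto
  have f: "integrable \<nu> f" and sets: "sets \<nu> = sets borel"
    and four: "\<And>\<eta>. \<eta> \<noteq> 0 \<Longrightarrow> vfourier \<nu> f \<eta> \<in> \<phi> \<eta>"
    using M by (auto simp: in_M_phi_def)
  define L where "L = (\<integral>x. norm (f x) \<partial>\<nu>)"
  define D where "D = C * (2 * norm \<xi>) powr \<alpha> * L * norm w"
  have le: "norm (\<integral>x. character (real j *\<^sub>R v + \<xi>) x * cinner w (f x) \<partial>\<nu>) \<le> D * real j powr - \<alpha>"
    if j: "norm \<xi> < real j" for j
  proof -
    define \<eta> where "\<eta> = real j *\<^sub>R v + \<xi>"
    have \<eta>: "\<eta> \<noteq> 0"
      using dist_normalize_le(1)[OF v j] by (simp add: \<eta>_def)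
    have "norm (cinner w (vfourier \<nu> f \<eta>)) \<le> grass_dist (\<phi> \<eta>) (\<phi> v) * norm (vfourier \<nu> f \<eta>) * norm w"
      using w by (intro norm_cinner_le_grass_dist sub \<eta> v0 four)
    also have "\<dots> \<le> (C * (2 * norm \<xi> / real j) powr \<alpha>) * L * norm w"
      unfolding L_def using C(1) C(2)[OF v j]
      by (intro mult_right_mono mult_mono fourier_cinner(2)[OF f sets]) (auto simp: \<eta>_def)
    also have "(2 * norm \<xi> / real j) powr \<alpha> = (2 * norm \<xi>) powr \<alpha> * real j powr - \<alpha>"
      by (subst powr_divide) (auto simp: powr_minus divide_inverse)
    also have "C * \<dots> * L * norm w = D * real j powr - \<alpha>"
      by (simp add: D_def)
    finally show ?thesis
      by (simp add: fourier_cinner(1)[OF f sets] \<eta>_def)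
  qed
  \<comment> \<open>The estimate needs j > norm \<xi>; the finitely many smaller indices do not
    affect summability.\<close>
  obtain N where N: "norm \<xi> < real N"
    using reals_Archimedean2 by blast
  show ?thesis
  proof (rule summable_comparison_test')
    show "summable (\<lambda>j. D\<^sup>2 * real j powr (- 2 * \<alpha>))"
      using \<alpha> by (intro summable_mult) (simp add: summable_real_powr_iff)
    fix j assume "N \<le> j"
    then have "norm \<xi> < real j" using N by linarith
    from power_mono[OF le[OF this] norm_ge_zero, of 2]
    show "norm ((norm (\<integral>x. character (real j *\<^sub>R v + \<xi>) x * cinner w (f x) \<partial>\<nu>))\<^sup>2) \<le> D\<^sup>2 * real j powr (- 2 * \<alpha>)"
      by (simp add: power_mult_distrib power2_eq_square[of "_ powr _"] powr_add[symmetric])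
  qed
qed

text \<open>The Riesz type argument only reaches the preimage of a circle set, which may be larger
  than \<open>K\<close>. Applied with every shift \<xi>, it shows that the restriction of the
  measure to that preimage has zero transform; uniqueness then localises to
  \<open>K\<close>.\<close>

lemma integral_compact_null_projection_eq_0:
  fixes v :: "'a::euclidean_space"
  assumes sets: "sets \<nu> = sets borel" and g: "integrable \<nu> g"
    and sum: "\<And>\<xi>. summable (\<lambda>j. (norm (\<integral>x. character (real j *\<^sub>R v + \<xi>) x * g x \<partial>\<nu>))\<^sup>2)"
    and K: "compact K" "(\<lambda>x. x \<bullet> v) ` K \<in> null_sets lebesgue"
  shows "(\<integral>x. indicator K x * g x \<partial>\<nu>) = 0"
proof -
  define E where "E = (\<lambda>y. cis (- 2 * pi * y)) ` (\<lambda>x. x \<bullet> v) ` K"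
  define h where "h x = (indicator E (cis (- 2 * pi * (x \<bullet> v))) :: complex)" for x
  have cK: "compact ((\<lambda>x. x \<bullet> v) ` K)"
    by (intro compact_continuous_image K continuous_intros)
  then have "compact E"
    unfolding E_def by (intro compact_continuous_image[OF _ cK] continuous_intros)
  then have E: "E \<in> sets borel" by (rule borel_compact)
  have "(\<lambda>x. cis (- 2 * pi * (x \<bullet> v))) \<in> borel_measurable borel"
    by (intro borel_measurable_continuous_onI continuous_intros)
  then have "h \<in> borel_measurable borel"
    using measurable_compose[OF _ borel_measurable_indicator[OF E]] by (simp add: h_def[abs_def])
  then have h_meas: "h \<in> borel_measurable \<nu>"
    by (simp add: measurable_cong_sets[OF sets refl])
  have "fourier_null \<nu> (\<lambda>x. h x * g x)"
    unfolding fourier_null_def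
  proof (intro conjI allI)
    show "integrable \<nu> (\<lambda>x. h x * g x)"
      by (rule integrable_bounded_mult[where C = 1, OF h_meas _ g]) (simp add: h_def indicator_def)
    fix \<xi>
    have char: "character \<xi> \<in> borel_measurable \<nu>"
      by (simp add: measurable_cong_sets[OF sets refl])
    have p: "(\<lambda>x. x \<bullet> v) \<in> borel_measurable \<nu>"
      unfolding measurable_cong_sets[OF sets refl]
      by (intro borel_measurable_continuous_onI continuous_intros)
    \<comment> \<open>Absorbing the character into the density shifts the half-line of frequencies
      by \<xi>.\<close>
    have eq: "cis (- 2 * pi * (real j * (x \<bullet> v))) * (character \<xi> x * g x) =
        character (real j *\<^sub>R v + \<xi>) x * g x" for j x
      by (simp add: character_add mult.assoc) (simp add: character_def inner_commute mult.assoc)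
    have "(\<integral>x. h x * (character \<xi> x * g x) \<partial>\<nu>) = 0"
      unfolding h_def E_def
    proof (rule integral_indicator_circle_null_eq_0[OF cK K(2) p])
      show "integrable \<nu> (\<lambda>x. character \<xi> x * g x)"
        by (rule integrable_bounded_mult[where C = 1, OF char _ g]) simp
      show "summable (\<lambda>j. (norm (\<integral>x. cis (- 2 * pi * (real j * (x \<bullet> v))) * (character \<xi> x * g x) \<partial>\<nu>))\<^sup>2)"
        unfolding eq by (rule sum)
    qed
    then show "(\<integral>x. character \<xi> x * (h x * g x) \<partial>\<nu>) = 0"
      by (simp add: mult.left_commute)
  qed
  then have "(\<integral>x. indicator K x * (h x * g x) \<partial>\<nu>) = 0"
    using fourier_null_imp_integral_eq_0[OF sets] borel_compact[OF K(1)] by blast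
  moreover have "indicator K x * (h x * g x) = indicator K x * g x" for x
    by (auto simp: h_def E_def indicator_def)
  ultimately show ?thesis by simp
qed

theorem mainTheorem13:
  fixes \<phi> :: "real ^ 'n \<Rightarrow> (complex ^ 'm) set"
    and k :: nat and \<alpha> :: real
    and \<nu> :: "(real ^ 'n) measure" and f :: "real ^ 'n \<Rightarrow> complex ^ 'm"
    and A :: "(real ^ 'n) set"
  assumes "homogeneous_bundle k \<phi>"
    and "\<alpha> > 1/2" and "holder_on_sphere \<alpha> \<phi>"
    and "in_M_phi \<phi> \<nu> f"
    and "A \<in> sets borel"
  shows "null_dirs A \<subseteq> {u. norm u = 1 \<and> vmeasure_of \<nu> f A \<in> \<phi> u}"
proof
  fix v assume "v \<in> null_dirs A"
  then have v: "norm v = 1" and null: "(\<lambda>x. x \<bullet> v) ` A \<in> null_sets lebesgue"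
    by (auto simp: null_dirs_def)
  have sets: "sets \<nu> = sets borel" and fin: "finite_measure \<nu>" and f: "integrable \<nu> f"
    using assms(4) by (auto simp: in_M_phi_def)
  have "v \<noteq> 0" using v by auto
  then have "vec.subspace (\<phi> v)"
    using assms(1) unfolding homogeneous_bundle_def grassmannian_def by blast
  then have span: "span (\<phi> v) = \<phi> v"
    by (simp add: vec_subspace_imp_subspace)
  \<comment> \<open>Splitting off the component of the value at \<open>A\<close> orthogonal to the
    fibre; the aim is w = 0.\<close>
  obtain y w where y: "y \<in> \<phi> v" and orth: "\<And>u. u \<in> \<phi> v \<Longrightarrow> orthogonal w u"
    and decomp: "vmeasure_of \<nu> f A = y + w"
    using orthogonal_subspace_decomp_exists[of "\<phi> v" "vmeasure_of \<nu> f A"] unfolding span by metis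
  have w: "w \<bullet> u = 0" if "u \<in> \<phi> v" for u
    using orth[OF that] by (simp add: orthogonal_def)
  define g where "g x = cinner w (f x)" for x
  have g: "integrable \<nu> g"
    unfolding g_def by (rule integrable_bounded_linear[OF bounded_linear_cinner f])
  have "(\<integral>x. indicator A x * g x \<partial>\<nu>) = 0"
  proof (rule integral_indicator_eq_0_compact_imp[OF sets fin g assms(5)])
    fix K assume K: "compact K" "K \<subseteq> A"
    then have "(\<lambda>x. x \<bullet> v) ` K \<in> null_sets lebesgue"
      using null by (meson image_mono negligible_iff_null_sets negligible_subset)
    then show "(\<integral>x. indicator K x * g x \<partial>\<nu>) = 0"
      using summable_fourier_coefficients[OF assms(1-4) v w]
      by (intro integral_compact_null_projection_eq_0[OF sets g _ K(1)]) (simp_all add: g_def)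
  qed
  moreover have "cinner w (vmeasure_of \<nu> f A) = (\<integral>x. indicator A x * g x \<partial>\<nu>)"
  proof -
    have "integrable \<nu> (\<lambda>x. indicator A x *\<^sub>R f x)"
      using f assms(5) sets by (intro integrable_mult_indicator) auto
    from integral_bounded_linear[OF bounded_linear_cinner this, of w]
    have "cinner w (vmeasure_of \<nu> f A) = (\<integral>x. cinner w (indicator A x *\<^sub>R f x) \<partial>\<nu>)"
      by (simp add: vmeasure_of_def set_lebesgue_integral_def)
    also have "(\<lambda>x. cinner w (indicator A x *\<^sub>R f x)) = (\<lambda>x. indicator A x * g x)"
      by (simp add: fun_eq_iff g_def indicator_def linear_0[OF bounded_linear.linear[OF bounded_linear_cinner]])
    finally show ?thesis .
  qed
  \<comment> \<open>Since \<open>w\<close> is orthogonal to \<open>y\<close>, the left side is the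
    squared norm of \<open>w\<close>.\<close>
  ultimately have "w \<bullet> (y + w) = 0"
    using Re_cinner[of w "y + w"] by (simp add: decomp)
  then have "w = 0"
    using w[OF y] by (simp add: inner_add_right)
  then show "v \<in> {u. norm u = 1 \<and> vmeasure_of \<nu> f A \<in> \<phi> u}"
    using v y decomp by simp
qed

end
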